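(* Let $n$ be a positive integer. Every subgroup $\Delta$ of finite index $n$ in $\pi_1(\mathcal{B}_1)$ is isomorphic to either $\mathbb{Z}^3$, or $\pi_1(\mathcal{B}_1)$, or $\pi_1(\mathcal{B}_2)$, and the numbers of subgroups of index $n$ of each type are $$\text{(i)}\quad s_{\mathbb{Z}^3,\pi_1(\mathcal{B}_1)}(n)=\sum_{2l\mid n}\sigma_1(l)\,l,$$ $$\text{(ii)}\quad s_{\pi_1(\mathcal{B}_1),\pi_1(\mathcal{B}_1)}(n)=\sum_{l\mid n}\sigma_1\!\left(\frac{n}{l}\right)l-\sum_{2l\mid n}\sigma_1\!\left(\frac{n}{2l}\right)l,$$ $$\text{(iii)}\quad s_{\pi_1(\mathcal{B}_2),\pi_1(\mathcal{B}_1)}(n)=\sum_{2l\mid n}2l\,\sigma_1\!\left(\frac{n}{2l}\right)-\sum_{4l\mid n}2l\,\sigma_1\!\left(\frac{n}{4l}\right).$$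
   Context: $\pi_1(\mathcal{B}_1)=\langle a,b,c : cac^{-1}a^{-1}=cbc^{-1}b^{-1}=1,\ aba^{-1}b=1\rangle$ and $\pi_1(\mathcal{B}_2)=\langle \alpha,\beta,\gamma : \gamma\beta\gamma^{-1}=\alpha\gamma\alpha^{-1}\gamma^{-1}=\beta,\ \alpha\beta\alpha^{-1}=\beta^{-1}\rangle$ are the fundamental groups of the non-orientable closed flat 3-manifolds $\mathcal{B}_1$ and $\mathcal{B}_2$ (first and second amphicosm). For groups $H,G$, $s_{H,G}(n)$ denotes the number of subgroups of index $n$ in $G$ that are isomorphic to $H$. $\sigma_1(m)=\sum_{k\mid m}k$ is the sum of positive divisors if $m$ is a positive integer. A sum $\sum_{jl\mid n}$ (with $j$ a fixed integer) runs over all positive integers $l$ such that $jl$ divides $n$, and equals $0$ if there are none. *)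

theory Defs
  imports "HOL-Algebra.Elementary_Groups"
begin

subsection \<open>Groups given by generators and relations\<close>

datatype 'g letter = Gen 'g | Inv 'g

type_synonym 'g word = "'g letter list"

text \<open>
  A relation \<open>u = v\<close> is encoded as the pair \<open>(u, v)\<close> of words. The predicate below is the
  least congruence on words that identifies the two sides of every relation and cancels
  every generator against its formal inverse.
\<close>

inductive pres_eq :: "('g word \<times> 'g word) set \<Rightarrow> 'g word \<Rightarrow> 'g word \<Rightarrow> bool"
  for R where
  refl: "pres_eq R u u"
| sym: "pres_eq R u v \<Longrightarrow> pres_eq R v u"
| trans: "pres_eq R u v \<Longrightarrow> pres_eq R v w \<Longrightarrow> pres_eq R u w"
| cancel_right: "pres_eq R (u @ [Gen x, Inv x] @ v) (u @ v)"
| cancel_left: "pres_eq R (u @ [Inv x, Gen x] @ v) (u @ v)"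
| relation: "(l, r) \<in> R \<Longrightarrow> pres_eq R (u @ l @ v) (u @ r @ v)"

definition word_class :: "('g word \<times> 'g word) set \<Rightarrow> 'g word \<Rightarrow> 'g word set"
  where "word_class R u = {v. pres_eq R u v}"

text \<open>The generators are all elements of the type \<open>'g\<close>.\<close>

definition presented_group :: "('g word \<times> 'g word) set \<Rightarrow> 'g word set monoid"
  where "presented_group R =
    \<lparr>carrier = range (word_class R),
     monoid.mult = (\<lambda>A B. \<Union>u\<in>A. \<Union>v\<in>B. word_class R (u @ v)),
     one = word_class R []\<rparr>"

lemma pres_eq_append:
  assumes "pres_eq R u u'" "pres_eq R v v'"
  shows "pres_eq R (u @ v) (u' @ v')"
proof -
  have "pres_eq R (x @ u @ y) (x @ u' @ y)" if "pres_eq R u u'" for u u' x y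
    using that
  proof induction
    case (cancel_right u z v)
    show ?case using pres_eq.cancel_right[of R "x @ u" z "v @ y"] by simp
  next
    case (cancel_left u z v)
    show ?case using pres_eq.cancel_left[of R "x @ u" z "v @ y"] by simp
  next
    case (relation l r u v)
    then show ?case using pres_eq.relation[of l r R "x @ u" "v @ y"] by simp
  next
    case (trans u v w)
    from trans.IH show ?case by (rule pres_eq.trans)
  next
    case (refl u)
    show ?case by (rule pres_eq.refl)
  next
    case (sym u v)
    from sym.IH show ?case by (rule pres_eq.sym)
  qed
  from this[OF assms(1), of "[]" v] this[OF assms(2), of u' "[]"]
  have "pres_eq R (u @ v) (u' @ v)" "pres_eq R (u' @ v) (u' @ v')"
    by simp_all
  then show ?thesis by (rule pres_eq.trans)
qed

lemma word_class_eq_iff: "word_class R u = word_class R v \<longleftrightarrow> pres_eq R u v"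
proof
  assume "word_class R u = word_class R v"
  moreover have "v \<in> word_class R v"
    by (simp add: word_class_def pres_eq.refl)
  ultimately have "v \<in> word_class R u"
    by simp
  then show "pres_eq R u v"
    by (simp add: word_class_def)
next
  assume "pres_eq R u v"
  then have "pres_eq R u w \<longleftrightarrow> pres_eq R v w" for w
    by (metis pres_eq.sym pres_eq.trans)
  then show "word_class R u = word_class R v"
    by (simp add: word_class_def)
qed

lemma carrier_presented_group: "carrier (presented_group R) = range (word_class R)"
  by (simp add: presented_group_def)

lemma one_presented_group: "\<one>\<^bsub>presented_group R\<^esub> = word_class R []"
  by (simp add: presented_group_def)

lemma mult_word_class:
  "word_class R u \<otimes>\<^bsub>presented_group R\<^esub> word_class R v = word_class R (u @ v)"
proof -
  have "word_class R (u' @ v') = word_class R (u @ v)"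
    if "u' \<in> word_class R u" "v' \<in> word_class R v" for u' v'
    using that unfolding word_class_eq_iff
    by (simp add: word_class_def pres_eq_append pres_eq.sym)
  moreover have "u \<in> word_class R u" "v \<in> word_class R v"
    by (auto simp: word_class_def intro: pres_eq.refl)
  ultimately have "(\<Union>u'\<in>word_class R u. \<Union>v'\<in>word_class R v. word_class R (u' @ v')) =
      word_class R (u @ v)"
    by blast
  then show ?thesis
    by (simp add: presented_group_def)
qed

fun inv_letter :: "'g letter \<Rightarrow> 'g letter" where
  "inv_letter (Gen x) = Inv x"
| "inv_letter (Inv x) = Gen x"

lemma pres_eq_inverse: "pres_eq R (rev (map inv_letter u) @ u) []"
proof (induction u)
  case Nil
  show ?case by (simp add: pres_eq.refl)
next
  case (Cons x u)
  have "pres_eq R (rev (map inv_letter u) @ [inv_letter x, x] @ u) (rev (map inv_letter u) @ u)"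
  proof (cases x)
    case (Gen y)
    show ?thesis unfolding Gen inv_letter.simps by (rule pres_eq.cancel_left)
  next
    case (Inv y)
    show ?thesis unfolding Inv inv_letter.simps by (rule pres_eq.cancel_right)
  qed
  from pres_eq.trans[OF this Cons] show ?case by simp
qed

lemma group_presented_group: "group (presented_group R)"
proof (rule groupI)
  fix A assume "A \<in> carrier (presented_group R)"
  then obtain u where "A = word_class R u"
    by (auto simp: carrier_presented_group)
  then show "\<exists>B\<in>carrier (presented_group R). B \<otimes>\<^bsub>presented_group R\<^esub> A = \<one>\<^bsub>presented_group R\<^esub>"
    by (intro bexI[of _ "word_class R (rev (map inv_letter u))"])
      (simp_all add: carrier_presented_group one_presented_group mult_word_class
        word_class_eq_iff pres_eq_inverse rangeI)
qed (auto simp: carrier_presented_group one_presented_group mult_word_class)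

subsection \<open>The groups of the first and the second amphicosm\<close>

datatype gens_B1 = a | b | c

definition pi1_B1 :: "gens_B1 word set monoid"
  where "pi1_B1 = presented_group
    {([Gen c, Gen a, Inv c, Inv a], []),
     ([Gen c, Gen b, Inv c, Inv b], []),
     ([Gen a, Gen b, Inv a, Gen b], [])}"

datatype gens_B2 = \<alpha> | \<beta> | \<gamma>

definition pi1_B2 :: "gens_B2 word set monoid"
  where "pi1_B2 = presented_group
    {([Gen \<gamma>, Gen \<beta>, Inv \<gamma>], [Gen \<beta>]),
     ([Gen \<alpha>, Gen \<gamma>, Inv \<alpha>, Inv \<gamma>], [Gen \<beta>]),
     ([Gen \<alpha>, Gen \<beta>, Inv \<alpha>], [Inv \<beta>])}"

hide_const (open) a b c \<alpha> \<beta> \<gamma>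

definition Z3 :: "(int \<times> int \<times> int) monoid"
  where "Z3 = integer_group \<times>\<times> integer_group \<times>\<times> integer_group"

subsection \<open>Counting subgroups of finite index\<close>

text \<open>
  Since \<open>card\<close> of an infinite set is \<open>0\<close>, the condition below says for positive \<open>n\<close> that the
  index of \<open>D\<close> is finite and equal to \<open>n\<close>.
\<close>

definition subgroups_of_index :: "'a monoid \<Rightarrow> nat \<Rightarrow> 'a set set"
  where "subgroups_of_index G n = {D. subgroup D G \<and> card (rcosets\<^bsub>G\<^esub> D) = n}"

text \<open>
  This is the number of such subgroups only if there are finitely many of them.
\<close>

definition num_subgroups :: "'b monoid \<Rightarrow> 'a monoid \<Rightarrow> nat \<Rightarrow> nat"
  where "num_subgroups H G n = card {D \<in> subgroups_of_index G n. G\<lparr>carrier := D\<rparr> \<cong> H}"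

definition sigma1 :: "nat \<Rightarrow> nat"
  where "sigma1 m = (\<Sum>k | k dvd m. k)"

end

theory Submission
  imports Defs
begin

text \<open>
  \<open>\<pi>\<^sub>1(B\<^sub>1)\<close> is the set of integer triples with \<open>(x, y, z) (x', y', z') = (x + x', (-1)\<^bsup>x'\<^esup> y + y', z + z')\<close>,
  and \<open>\<pi>\<^sub>1(B\<^sub>2)\<close> is its subgroup of index 2 on which \<open>y + z\<close> is even. As for Hermite normal
  forms, projecting a subgroup of finite index successively to \<open>x\<close>, \<open>z\<close> and \<open>y\<close> yields unique generators
  \<open>U = (d, q, e)\<close>, \<open>V = (0, p, f)\<close>, \<open>B = (0, k, 0)\<close> with \<open>0 \<le> e < f\<close> and \<open>0 \<le> p, q < k\<close>, and its index is
  \<open>d f k\<close>. If \<open>d\<close> is even, the generators commute and the subgroup is free abelian. If \<open>d\<close> is odd,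
  the commutator of \<open>U\<close> and \<open>V\<close> forces \<open>k\<close> to divide \<open>2 p\<close>; then \<open>p = 0\<close> gives a copy of \<open>\<pi>\<^sub>1(B\<^sub>1)\<close> and
  \<open>k = 2 p\<close> one of \<open>\<pi>\<^sub>1(B\<^sub>2)\<close>. Counting the parameters yields the formulas, with the condition that
  \<open>d\<close> is odd turned into \<open>\<sigma>\<^sub>1(m) - \<sigma>\<^sub>1(m/2)\<close>.
\<close>

section \<open>Integer powers, and the two groups of triples\<close>

lemma int_step_induct:
  fixes P :: "int \<Rightarrow> bool"
  assumes "P 0" "\<And>m. P m \<Longrightarrow> P (m + 1)" "\<And>m. P m \<Longrightarrow> P (m - 1)"
  shows "P m"
  by (rule int_induct[of P 0]) (use assms in auto)

lemma is_isoI: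
  assumes "\<And>x. x \<in> carrier G \<Longrightarrow> h x \<in> carrier H"
    "\<And>x y. x \<in> carrier G \<Longrightarrow> y \<in> carrier G \<Longrightarrow> h (x \<otimes>\<^bsub>G\<^esub> y) = h x \<otimes>\<^bsub>H\<^esub> h y"
    "inj_on h (carrier G)" "h ` carrier G = carrier H"
  shows "G \<cong> H"
  using assms by (auto simp: is_iso_def iso_def hom_def bij_betw_def)

lemma (in group) int_pow_add1:
  assumes "x \<in> carrier G"
  shows "x [^] (m + 1 :: int) = x [^] m \<otimes> x"
    "x [^] (m - 1 :: int) = x [^] m \<otimes> inv x"
  using assms by (simp_all add: int_pow_mult int_pow_diff)

text \<open>The hypothesis says that conjugation by \<open>x\<close> takes \<open>v\<close> to
  \<open>u\<close>; as an automorphism it takes powers to powers, negative ones included.\<close>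

lemma (in group) int_pow_swap:
  fixes m :: int
  assumes "u \<in> carrier G" "v \<in> carrier G" "x \<in> carrier G" "u \<otimes> x = x \<otimes> v"
  shows "u [^] m \<otimes> x = x \<otimes> v [^] m"
proof (induction m rule: int_step_induct)
  case (2 m)
  have "u [^] m \<otimes> u \<otimes> x = u [^] m \<otimes> x \<otimes> v"
    using assms by (simp add: m_assoc)
  with 2 assms show ?case by (simp add: int_pow_add1 m_assoc)
next
  case (3 m)
  have "inv u \<otimes> x = x \<otimes> inv v"
    using assms by (metis inv_closed inv_solve_left inv_solve_right m_assoc m_closed)
  then have "u [^] m \<otimes> inv u \<otimes> x = u [^] m \<otimes> x \<otimes> inv v"
    using assms by (simp add: m_assoc)
  with 3 assms show ?case by (simp add: int_pow_add1 m_assoc)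
qed (use assms in simp)

text \<open>This is \<open>(-1)^x * y\<close>, expressed by the parity of \<open>x\<close> so that
  negative \<open>x\<close> is covered.\<close>

definition flip :: "int \<Rightarrow> int \<Rightarrow> int"
  where "flip x y = (if even x then y else - y)"

lemma flip_simps [simp]:
  "flip 0 y = y" "flip x 0 = 0" "flip 1 y = - y" "flip (- x) y = flip x y"
  "flip x (- y) = - flip x y" "flip x (flip x y) = y" "even (flip x y) = even y"
  by (simp_all add: flip_def)

lemma flip_add: "flip x (y + y') = flip x y + flip x y'" "flip (x + x') y = flip x (flip x' y)"
  by (simp_all add: flip_def)

text \<open>
  The triple \<open>(x, y, z)\<close> stands for \<open>a\<^sup>x b\<^sup>y c\<^sup>z\<close> in \<open>\<pi>\<^sub>1(B\<^sub>1)\<close>. In \<open>KZ2\<close> the generators of \<open>\<pi>\<^sub>1(B\<^sub>2)\<close> are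
  \<open>\<alpha> = (1, 0, 0)\<close>, \<open>\<beta> = (0, -2, 0)\<close> and \<open>\<gamma> = (0, 1, 1)\<close>.
\<close>

definition KZ :: "(int \<times> int \<times> int) monoid"
  where "KZ = \<lparr>carrier = UNIV,
    monoid.mult = (\<lambda>(x, y, z) (x', y', z'). (x + x', flip x' y + y', z + z')),
    one = (0, 0, 0)\<rparr>"

definition KZ2 :: "(int \<times> int \<times> int) monoid"
  where "KZ2 = KZ\<lparr>carrier := {(x, y, z). even (y + z)}\<rparr>"

lemma KZ_simps [simp]:
  "carrier KZ = UNIV" "(x, y, z) \<otimes>\<^bsub>KZ\<^esub> (x', y', z') = (x + x', flip x' y + y', z + z')"
  "\<one>\<^bsub>KZ\<^esub> = (0, 0, 0)"
  by (simp_all add: KZ_def)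

lemma KZ2_simps [simp]:
  "carrier KZ2 = {(x, y, z). even (y + z)}"
  "(x, y, z) \<otimes>\<^bsub>KZ2\<^esub> (x', y', z') = (x + x', flip x' y + y', z + z')"
  "\<one>\<^bsub>KZ2\<^esub> = (0, 0, 0)"
  by (simp_all add: KZ2_def)

lemma Z3_simps [simp]:
  "carrier Z3 = UNIV" "(x, y, z) \<otimes>\<^bsub>Z3\<^esub> (x', y', z') = (x + x', y + y', z + z')"
  by (simp_all add: Z3_def)

lemma group_KZ: "group KZ"
proof (rule groupI)
  fix u assume "u \<in> carrier KZ"
  show "\<exists>v\<in>carrier KZ. v \<otimes>\<^bsub>KZ\<^esub> u = \<one>\<^bsub>KZ\<^esub>"
    by (cases u, rename_tac x y z, rule_tac x = "(- x, - flip x y, - z)" in bexI) simp_all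
qed (auto simp: flip_add flip_def)

lemma inv_KZ [simp]: "inv\<^bsub>KZ\<^esub> (x, y, z) = (- x, - flip x y, - z)"
  by (rule group.inv_equality[OF group_KZ]) simp_all

lemma subgroup_KZ2: "subgroup (carrier KZ2) KZ"
  by (rule group.subgroupI[OF group_KZ]) (auto intro: exI[of _ 0])

lemma group_KZ2: "group KZ2"
  using group.subgroup_imp_group[OF group_KZ subgroup_KZ2] by (simp add: KZ2_def)

lemma group_Z3: "group Z3"
  unfolding Z3_def by (intro DirProd_group group_integer_group)

subsection \<open>Presentations\<close>

fun letter_val :: "('a, 'm) monoid_scheme \<Rightarrow> ('g \<Rightarrow> 'a) \<Rightarrow> 'g letter \<Rightarrow> 'a"
  where
    "letter_val H f (Gen x) = f x"
  | "letter_val H f (Inv x) = inv\<^bsub>H\<^esub> f x"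

fun word_val :: "('a, 'm) monoid_scheme \<Rightarrow> ('g \<Rightarrow> 'a) \<Rightarrow> 'g word \<Rightarrow> 'a"
  where
    "word_val H f [] = \<one>\<^bsub>H\<^esub>"
  | "word_val H f (x # w) = letter_val H f x \<otimes>\<^bsub>H\<^esub> word_val H f w"

lemma word_class_Inv: "word_class R [Inv x] = inv\<^bsub>presented_group R\<^esub> word_class R [Gen x]"
proof -
  interpret P: group "presented_group R" by (rule group_presented_group)
  show ?thesis
    using pres_eq.cancel_left[of R "[]" x "[]"]
    by (intro P.inv_equality[symmetric])
      (auto simp: mult_word_class one_presented_group word_class_eq_iff carrier_presented_group)
qed

lemma word_class_Gen_closed [simp]: "word_class R [Gen x] \<in> carrier (presented_group R)"
  by (simp add: carrier_presented_group)

lemma word_val_word_class: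
  "word_val (presented_group R) (\<lambda>x. word_class R [Gen x]) w = word_class R w"
proof (induction w)
  case (Cons x w)
  have "letter_val (presented_group R) (\<lambda>x. word_class R [Gen x]) x = word_class R [x]"
    by (cases x) (simp_all add: word_class_Inv)
  with Cons show ?case by (simp add: mult_word_class)
qed (simp add: one_presented_group)

text \<open>Unfolding \<open>word_val\<close> on both sides turns a relation of the presentation
  into an equation between products of generator classes.\<close>

lemma word_val_relation:
  assumes "(l, r) \<in> R"
  shows "word_val (presented_group R) (\<lambda>x. word_class R [Gen x]) l =
    word_val (presented_group R) (\<lambda>x. word_class R [Gen x]) r"
  using pres_eq.relation[OF assms, of "[]" "[]"] by (simp add: word_val_word_class word_class_eq_iff)

context group
begin

lemma letter_val_closed: "range f \<subseteq> carrier G \<Longrightarrow> letter_val G f x \<in> carrier G"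
  by (cases x) auto

lemma word_val_closed: "range f \<subseteq> carrier G \<Longrightarrow> word_val G f w \<in> carrier G"
  by (induction w) (auto simp: letter_val_closed)

lemma word_val_append:
  "range f \<subseteq> carrier G \<Longrightarrow> word_val G f (u @ v) = word_val G f u \<otimes> word_val G f v"
  by (induction u) (auto simp: letter_val_closed word_val_closed m_assoc)

lemma word_val_pres_eq:
  assumes f: "range f \<subseteq> carrier G"
    and R: "\<And>l r. (l, r) \<in> R \<Longrightarrow> word_val G f l = word_val G f r"
    and uv: "pres_eq R u v"
  shows "word_val G f u = word_val G f v"
  using uv
proof induction
  case (cancel_right u x v)
  have "f x \<in> carrier G" using f by auto
  with f show ?case
    by (simp add: word_val_append word_val_closed m_assoc[symmetric])
next
  case (cancel_left u x v)
  have "f x \<in> carrier G" using f by auto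
  with f show ?case
    by (simp add: word_val_append word_val_closed m_assoc[symmetric])
next
  case (relation l r u v)
  with f R[OF relation] show ?case by (simp add: word_val_append)
qed auto

text \<open>Von Dyck's theorem: evaluation at \<open>f\<close> respects the cancellations and
  relations that generate the congruence, so it is constant on word classes.\<close>

lemma presented_group_hom_exists:
  assumes f: "range f \<subseteq> carrier G"
    and R: "\<And>l r. (l, r) \<in> R \<Longrightarrow> word_val G f l = word_val G f r"
  obtains \<phi> where "\<phi> \<in> hom (presented_group R) G" "\<And>x. \<phi> (word_class R [Gen x]) = f x"
proof -
  define \<phi> where "\<phi> A = word_val G f (SOME w. A = word_class R w)" for A
  have phi: "\<phi> (word_class R w) = word_val G f w" for w
  proof -
    have "word_class R w = word_class R (SOME w'. word_class R w = word_class R w')"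
      by (rule someI) (rule HOL.refl)
    then show ?thesis
      unfolding \<phi>_def word_class_eq_iff using word_val_pres_eq[OF f R] by metis
  qed
  show ?thesis
  proof (rule that)
    show "\<phi> \<in> hom (presented_group R) G"
      by (auto simp: hom_def carrier_presented_group phi mult_word_class word_val_closed[OF f]
          word_val_append[OF f])
    show "\<phi> (word_class R [Gen x]) = f x" for x
    proof -
      have "f x \<in> carrier G" using f by auto
      then show ?thesis by (simp add: phi)
    qed
  qed
qed

text \<open>\<open>N\<close> sends an element of a concrete group to its normal form in the
  generators. It is onto because every word class is the image of the value of that word, and
  injective because the homomorphism from von Dyck's theorem undoes it.\<close>

lemma presented_group_iso:
  assumes f: "range f \<subseteq> carrier G"
    and R: "\<And>l r. (l, r) \<in> R \<Longrightarrow> word_val G f l = word_val G f r"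
    and N: "N \<in> hom G (presented_group R)" "\<And>x. N (f x) = word_class R [Gen x]"
    and inverse: "\<And>\<phi> y. \<phi> \<in> hom (presented_group R) G \<Longrightarrow>
      (\<And>x. \<phi> (word_class R [Gen x]) = f x) \<Longrightarrow> y \<in> carrier G \<Longrightarrow> \<phi> (N y) = y"
  shows "G \<cong> presented_group R"
proof -
  obtain \<phi> where phi: "\<phi> \<in> hom (presented_group R) G" "\<And>x. \<phi> (word_class R [Gen x]) = f x"
    using presented_group_hom_exists[OF f R] by blast
  interpret P: group "presented_group R" by (rule group_presented_group)
  interpret N: group_hom G "presented_group R" N by unfold_locales (rule N)
  have letter: "N (letter_val G f x) = word_class R [x]" for x
  proof (cases x)
    case (Inv y)
    have "f y \<in> carrier G" using f by auto
    then show ?thesis using Inv N(2) by (simp add: word_class_Inv)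
  qed (use N in auto)
  have word: "N (word_val G f w) = word_class R w" for w
    by (induction w)
      (use f in \<open>auto simp: letter one_presented_group[symmetric] mult_word_class
        letter_val_closed word_val_closed\<close>)
  show ?thesis
  proof (rule is_isoI)
    show "inj_on N (carrier G)"
      by (rule inj_on_inverseI[of _ \<phi>]) (rule inverse[OF phi])
    have "A \<in> N ` carrier G" if "A \<in> carrier (presented_group R)" for A
      using that word word_val_closed[OF f] by (force simp: carrier_presented_group)
    then show "N ` carrier G = carrier (presented_group R)" by auto
  qed auto
qed

text \<open>\<open>N y z\<close> stands for the element with exponents \<open>y\<close> and
  \<open>z\<close>, and \<open>Q\<close> selects the pairs that occur: all of them for
  \<open>KZ\<close>, those with even sum for \<open>KZ2\<close>. Each factor \<open>x\<close> that
  is passed changes the sign of \<open>y\<close>.\<close>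

lemma flip_swap:
  assumes "x \<in> carrier G"
    and N: "\<And>y z. Q y z \<Longrightarrow> N y z \<in> carrier G" "\<And>y z. Q y z \<Longrightarrow> Q (- y) z"
      "\<And>y z. Q y z \<Longrightarrow> N y z \<otimes> x = x \<otimes> N (- y) z"
    and "Q y z"
  shows "N y z \<otimes> x [^] m = x [^] m \<otimes> N (flip m y) z"
proof (induction m rule: int_step_induct)
  case (2 m)
  define y' where "y' = flip m y"
  have Q: "Q y' z" "Q (- y') z" using N(2) assms(5) by (simp_all add: flip_def y'_def)
  note closed = N(1)[OF Q(1)] N(1)[OF Q(2)] N(1)[OF assms(5)] assms(1)
  have "N y z \<otimes> (x [^] m \<otimes> x) = x [^] m \<otimes> (N y' z \<otimes> x)"
    using 2 closed by (simp add: m_assoc[symmetric] y'_def)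
  also have "\<dots> = x [^] m \<otimes> x \<otimes> N (- y') z"
    using N(3)[OF Q(1)] closed by (simp add: m_assoc)
  also have "- y' = flip (m + 1) y" by (simp add: y'_def flip_def)
  finally show ?case using assms(1) by (simp add: int_pow_add1)
next
  case (3 m)
  define y' where "y' = flip m y"
  have Q: "Q y' z" "Q (- y') z" using N(2) assms(5) by (simp_all add: flip_def y'_def)
  note closed = N(1)[OF Q(1)] N(1)[OF Q(2)] N(1)[OF assms(5)] assms(1)
  \<comment> \<open>The hypothesis at \<open>- y'\<close>, multiplied by \<open>inv x\<close> on
    both sides.\<close>
  have "N y' z \<otimes> inv x = inv x \<otimes> N (- y') z"
    using N(3)[OF Q(2)] closed
    by (metis inv_closed inv_solve_left inv_solve_right m_assoc m_closed minus_minus)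
  moreover have "N y z \<otimes> (x [^] m \<otimes> inv x) = x [^] m \<otimes> (N y' z \<otimes> inv x)"
    using 3 closed by (simp add: m_assoc[symmetric] y'_def)
  ultimately have "N y z \<otimes> (x [^] m \<otimes> inv x) = x [^] m \<otimes> inv x \<otimes> N (- y') z"
    using closed by (simp add: m_assoc)
  also have "- y' = flip (m - 1) y" by (simp add: y'_def flip_def)
  finally show ?case using assms(1) by (simp add: int_pow_add1)
qed (use assms in simp)

text \<open>Collecting the powers of \<open>x\<close> on the left produces the twisted addition of
  triples, so the products \<open>x [^] m \<otimes> N y z\<close> multiply by the law of
  \<open>KZ\<close>.\<close>

lemma flip_mult:
  assumes x: "x \<in> carrier G"
    and N: "\<And>y z. Q y z \<Longrightarrow> N y z \<in> carrier G" "\<And>y z. Q y z \<Longrightarrow> Q (- y) z"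
      "\<And>y z. Q y z \<Longrightarrow> N y z \<otimes> x = x \<otimes> N (- y) z"
    and add: "\<And>y z y' z'. Q y z \<Longrightarrow> Q y' z' \<Longrightarrow> N (y + y') (z + z') = N y z \<otimes> N y' z'"
    and Q: "Q y z" "Q y' z'"
  shows "x [^] (m + m') \<otimes> N (flip m' y + y') (z + z') =
    x [^] (m :: int) \<otimes> N y z \<otimes> (x [^] m' \<otimes> N y' z')"
proof -
  have Qf: "Q (flip m' y) z" using N(2) Q by (simp add: flip_def)
  note closed = N(1)[OF Qf] N(1)[OF Q(1)] N(1)[OF Q(2)] x
  have "x [^] m \<otimes> N y z \<otimes> (x [^] m' \<otimes> N y' z') = x [^] m \<otimes> (N y z \<otimes> x [^] m') \<otimes> N y' z'"
    using closed by (simp add: m_assoc)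
  also have "\<dots> = x [^] m \<otimes> (x [^] m' \<otimes> N (flip m' y) z) \<otimes> N y' z'"
    by (subst flip_swap[of x Q N]) (use x N Q in auto)
  also have "\<dots> = x [^] (m + m') \<otimes> N (flip m' y + y') (z + z')"
    using closed by (simp add: m_assoc int_pow_mult add[OF Qf Q(2)])
  finally show ?thesis ..
qed

end

section \<open>Homomorphisms from the groups of triples\<close>

lemma (in group) commutator_eq_one:
  assumes "x \<otimes> (y \<otimes> (inv x \<otimes> inv y)) = \<one>" "x \<in> carrier G" "y \<in> carrier G"
  shows "x \<otimes> y = y \<otimes> x"
proof -
  have "x \<otimes> y \<otimes> inv (y \<otimes> x) = \<one>"
    using assms by (simp add: m_assoc inv_mult_group)
  then have "inv (inv (y \<otimes> x)) = x \<otimes> y"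
    using assms(2,3) by (intro inv_equality) auto
  then show ?thesis using assms(2,3) by simp
qed

lemma (in group) conj_inv_swap:
  assumes "x \<otimes> y \<otimes> inv x = inv y" "x \<in> carrier G" "y \<in> carrier G"
  shows "y \<otimes> x = x \<otimes> inv y"
proof -
  have "x \<otimes> y = inv y \<otimes> x"
    using assms inv_solve_right'[of "inv y" "x \<otimes> y" x] by simp
  then have "y \<otimes> (x \<otimes> y) = x" using assms(2,3) by (simp add: m_assoc[symmetric])
  then have "y \<otimes> x \<otimes> y = x" using assms(2,3) by (simp add: m_assoc)
  then show ?thesis using assms(2,3) inv_solve_right[of "y \<otimes> x" x y] by simp
qed

lemma KZ_int_pow [simp]:
  "(1, 0, 0) [^]\<^bsub>KZ\<^esub> (m :: int) = (m, 0, 0)"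
  "(0, y, z) [^]\<^bsub>KZ\<^esub> (m :: int) = (0, m * y, m * z)"
  by (induction m rule: int_step_induct)
    (simp_all add: group.int_pow_add1[OF group_KZ] monoid.nat_pow_0 algebra_simps)

lemma KZ2_int_pow: "u \<in> carrier KZ2 \<Longrightarrow> u [^]\<^bsub>KZ2\<^esub> (m :: int) = u [^]\<^bsub>KZ\<^esub> m"
  using group.int_pow_consistent[OF group_KZ subgroup_KZ2, of u m] by (simp add: KZ2_def)

lemma KZ2_inv: "u \<in> carrier KZ2 \<Longrightarrow> inv\<^bsub>KZ2\<^esub> u = inv\<^bsub>KZ\<^esub> u"
  using group.m_inv_consistent[OF group_KZ subgroup_KZ2, of u] by (simp add: KZ2_def)

lemma (in group) hom_from_KZ:
  assumes closed: "x \<in> carrier G" "y \<in> carrier G" "z \<in> carrier G"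
    and zx: "z \<otimes> x = x \<otimes> z" and zy: "z \<otimes> y = y \<otimes> z" and yx: "y \<otimes> x = x \<otimes> inv y"
  shows "(\<lambda>(k, l, m). x [^] k \<otimes> (y [^] l \<otimes> z [^] m)) \<in> hom KZ G"
proof -
  note zx' = int_pow_swap[OF closed(3,3,1) zx]
  note yx' = int_pow_swap[OF closed(2) inv_closed[OF closed(2)] closed(1) yx]
  \<comment> \<open>\<open>int_pow_swap\<close> is used twice, first for powers of \<open>y\<close>
    past \<open>z\<close>, then for powers of \<open>z\<close> past a power of
    \<open>y\<close>.\<close>
  have zy': "z [^] m \<otimes> y [^] l = y [^] l \<otimes> z [^] m" for l m :: int
    using int_pow_swap[OF _ _ _ int_pow_swap[OF closed(2,2,3) zy[symmetric], symmetric]] closed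
    by simp
  define N where "N l m = y [^] l \<otimes> z [^] m" for l m :: int
  have N_closed: "N l m \<in> carrier G" for l m
    using closed by (simp add: N_def)
  have N_swap: "N l m \<otimes> x = x \<otimes> N (- l) m" for l m
  proof -
    have "N l m \<otimes> x = (y [^] l \<otimes> x) \<otimes> z [^] m"
      using closed by (simp add: N_def m_assoc zx')
    then show ?thesis
      using closed by (simp add: N_def m_assoc yx' int_pow_neg int_pow_inv)
  qed
  have N_add: "N (l + l') (m + m') = N l m \<otimes> N l' m'" for l l' m m'
  proof -
    have "N l m \<otimes> N l' m' = y [^] l \<otimes> (z [^] m \<otimes> y [^] l') \<otimes> z [^] m'"
      using closed by (simp add: N_def m_assoc)
    then show ?thesis
      using closed by (simp add: N_def zy' m_assoc int_pow_mult)
  qed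
  show ?thesis
    using closed N_closed flip_mult[of x "\<lambda>_ _. True" N, OF closed(1) N_closed _ N_swap N_add]
    by (auto simp: hom_def simp flip: N_def)
qed

text \<open>With \<open>x\<close>, \<open>y\<close>, \<open>z\<close> in the roles of \<alpha>,
  \<beta>, \<gamma>, the product \<beta>^t \<gamma>^m is the triple
  \<open>(0, m - 2 * t, m)\<close>. Solving for \<open>t\<close> gives the exponent
  \<open>(m - l) div 2\<close>, which is exact because \<open>l + m\<close> is even.\<close>

lemma (in group) hom_from_KZ2:
  assumes closed: "x \<in> carrier G" "y \<in> carrier G" "z \<in> carrier G"
    and zx: "z \<otimes> x = x \<otimes> (z \<otimes> y)" and zy: "z \<otimes> y = y \<otimes> z" and yx: "y \<otimes> x = x \<otimes> inv y"
  shows "(\<lambda>(k, l, m). x [^] k \<otimes> (y [^] ((m - l) div 2) \<otimes> z [^] m)) \<in> hom KZ2 G"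
proof -
  note zx' = int_pow_swap[OF closed(3) m_closed[OF closed(3,2)] closed(1) zx]
  note yx' = int_pow_swap[OF closed(2) inv_closed[OF closed(2)] closed(1) yx]
  have zy': "z [^] m \<otimes> y [^] l = y [^] l \<otimes> z [^] m" for l m :: int
    using int_pow_swap[OF _ _ _ int_pow_swap[OF closed(2,2,3) zy[symmetric], symmetric]] closed
    by simp
  define N where "N l m = y [^] ((m - l) div 2) \<otimes> z [^] m" for l m :: int
  have N_closed: "N l m \<in> carrier G" for l m
    using closed by (simp add: N_def)
  have N_swap: "N l m \<otimes> x = x \<otimes> N (- l) m" if "even (l + m)" for l m
  proof -
    define t where "t = (m - l) div 2"
    have t: "l = m - 2 * t" using that by (auto simp: t_def)
    have "N l m \<otimes> x = (y [^] t \<otimes> x) \<otimes> (z \<otimes> y) [^] m"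
      using closed by (simp add: N_def m_assoc zx' flip: t_def)
    \<comment> \<open>Conjugation by \<open>x\<close> inverts \<open>y\<close> and contributes a
      \<open>y\<close> for each \<open>z\<close>; the total exponent \<open>m - t\<close> is the one
      belonging to \<open>- l\<close>.\<close>
    also have "\<dots> = x \<otimes> (y [^] (- t) \<otimes> (y [^] m \<otimes> z [^] m))"
      using closed by (simp add: m_assoc yx' int_pow_neg int_pow_inv zy int_pow_mult_distrib)
    also have "\<dots> = x \<otimes> (y [^] (- t + m) \<otimes> z [^] m)"
      unfolding int_pow_mult[OF closed(2)] using closed by (simp add: m_assoc)
    also have "- t + m = (m - (- l)) div 2" by (simp add: t)
    finally show ?thesis by (simp add: N_def)
  qed
  have N_add: "N (l + l') (m + m') = N l m \<otimes> N l' m'"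
    if "even (l + m)" "even (l' + m')" for l l' m m'
  proof -
    define t where "t = (m - l) div 2"
    define t' where "t' = (m' - l') div 2"
    have "l = m - 2 * t" "l' = m' - 2 * t'" using that by (auto simp: t_def t'_def)
    then have "m + m' - (l + l') = 2 * (t + t')" by simp
    then have tt: "(m + m' - (l + l')) div 2 = t + t'" by simp
    have "N l m \<otimes> N l' m' = y [^] t \<otimes> (z [^] m \<otimes> y [^] t') \<otimes> z [^] m'"
      using closed by (simp add: N_def m_assoc flip: t_def t'_def)
    then show ?thesis
      using closed unfolding N_def tt t_def[symmetric] t'_def[symmetric]
      by (simp add: zy' m_assoc int_pow_mult)
  qed
  show ?thesis
    using closed N_closed
      flip_mult[of x "\<lambda>l m. even (l + m)" N, OF closed(1) N_closed _ N_swap N_add]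
    by (auto simp: hom_def simp flip: N_def)
qed

section \<open>The two presentations identified with groups of triples\<close>

lemma KZ_iso_pi1_B1: "KZ \<cong> pi1_B1"
proof -
  define R :: "(gens_B1 word \<times> gens_B1 word) set" where
    "R = {([Gen gens_B1.c, Gen gens_B1.a, Inv gens_B1.c, Inv gens_B1.a], []),
      ([Gen gens_B1.c, Gen gens_B1.b, Inv gens_B1.c, Inv gens_B1.b], []),
      ([Gen gens_B1.a, Gen gens_B1.b, Inv gens_B1.a, Gen gens_B1.b], [])}"
  have mem_R: "([Gen gens_B1.c, Gen gens_B1.a, Inv gens_B1.c, Inv gens_B1.a], []) \<in> R"
    "([Gen gens_B1.c, Gen gens_B1.b, Inv gens_B1.c, Inv gens_B1.b], []) \<in> R"
    "([Gen gens_B1.a, Gen gens_B1.b, Inv gens_B1.a, Gen gens_B1.b], []) \<in> R"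
    by (simp_all add: R_def)
  interpret KZ: group KZ by (rule group_KZ)
  define P where "P = presented_group R"
  interpret P: group P unfolding P_def by (rule group_presented_group)
  define A where "A = word_class R [Gen gens_B1.a]"
  define B where "B = word_class R [Gen gens_B1.b]"
  define C where "C = word_class R [Gen gens_B1.c]"
  have closed: "A \<in> carrier P" "B \<in> carrier P" "C \<in> carrier P"
    by (simp_all add: A_def B_def C_def P_def)
  note rels = mem_R[THEN word_val_relation, unfolded word_val.simps letter_val.simps,
      folded A_def B_def C_def P_def]
  have "C \<otimes>\<^bsub>P\<^esub> A = A \<otimes>\<^bsub>P\<^esub> C" "C \<otimes>\<^bsub>P\<^esub> B = B \<otimes>\<^bsub>P\<^esub> C"
    by (rule P.commutator_eq_one; use closed rels in simp)+
  moreover have "A \<otimes>\<^bsub>P\<^esub> B \<otimes>\<^bsub>P\<^esub> inv\<^bsub>P\<^esub> A = inv\<^bsub>P\<^esub> B"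
    by (rule P.inv_equality[symmetric]) (use closed rels in \<open>simp_all add: P.m_assoc\<close>)
  then have "B \<otimes>\<^bsub>P\<^esub> A = A \<otimes>\<^bsub>P\<^esub> inv\<^bsub>P\<^esub> B"
    using closed by (intro P.conj_inv_swap)
  ultimately have hom: "(\<lambda>(k, l, m). A [^]\<^bsub>P\<^esub> k \<otimes>\<^bsub>P\<^esub> (B [^]\<^bsub>P\<^esub> l \<otimes>\<^bsub>P\<^esub> C [^]\<^bsub>P\<^esub> m)) \<in> hom KZ P"
    by (intro P.hom_from_KZ closed)
  define f where "f g = (case g of gens_B1.a \<Rightarrow> (1, 0, 0) | gens_B1.b \<Rightarrow> (0, 1, 0) |
    gens_B1.c \<Rightarrow> (0 :: int, 0 :: int, 1 :: int))" for g
  have "KZ \<cong> P"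
  proof (rule KZ.presented_group_iso[of f R, OF _ _ hom[unfolded P_def], folded P_def])
    show "word_val KZ f l = word_val KZ f r" if "(l, r) \<in> R" for l r
      using that by (auto simp: R_def f_def)
    show "(case f g of (k, l, m) \<Rightarrow> A [^]\<^bsub>P\<^esub> k \<otimes>\<^bsub>P\<^esub> (B [^]\<^bsub>P\<^esub> l \<otimes>\<^bsub>P\<^esub> C [^]\<^bsub>P\<^esub> m)) = word_class R [Gen g]" for g
      using closed by (cases g) (simp_all add: f_def flip: A_def B_def C_def)
    fix \<phi> u
    assume phi: "\<phi> \<in> hom P KZ" "\<And>x. \<phi> (word_class R [Gen x]) = f x"
    interpret phi: group_hom P KZ \<phi> by unfold_locales (rule phi)
    have "\<phi> A = (1, 0, 0)" "\<phi> B = (0, 1, 0)" "\<phi> C = (0, 0, 1)"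
      by (simp_all add: A_def B_def C_def phi(2) f_def)
    then show "\<phi> (case u of (k, l, m) \<Rightarrow> A [^]\<^bsub>P\<^esub> k \<otimes>\<^bsub>P\<^esub> (B [^]\<^bsub>P\<^esub> l \<otimes>\<^bsub>P\<^esub> C [^]\<^bsub>P\<^esub> m)) = u"
      using closed by (cases u) (simp add: phi.hom_int_pow)
  qed simp
  then show ?thesis by (simp add: pi1_B1_def R_def P_def)
qed

lemma KZ2_iso_pi1_B2: "KZ2 \<cong> pi1_B2"
proof -
  define R :: "(gens_B2 word \<times> gens_B2 word) set" where
    "R = {([Gen gens_B2.\<gamma>, Gen gens_B2.\<beta>, Inv gens_B2.\<gamma>], [Gen gens_B2.\<beta>]),
      ([Gen gens_B2.\<alpha>, Gen gens_B2.\<gamma>, Inv gens_B2.\<alpha>, Inv gens_B2.\<gamma>], [Gen gens_B2.\<beta>]),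
      ([Gen gens_B2.\<alpha>, Gen gens_B2.\<beta>, Inv gens_B2.\<alpha>], [Inv gens_B2.\<beta>])}"
  have mem_R: "([Gen gens_B2.\<gamma>, Gen gens_B2.\<beta>, Inv gens_B2.\<gamma>], [Gen gens_B2.\<beta>]) \<in> R"
    "([Gen gens_B2.\<alpha>, Gen gens_B2.\<gamma>, Inv gens_B2.\<alpha>, Inv gens_B2.\<gamma>], [Gen gens_B2.\<beta>]) \<in> R"
    "([Gen gens_B2.\<alpha>, Gen gens_B2.\<beta>, Inv gens_B2.\<alpha>], [Inv gens_B2.\<beta>]) \<in> R"
    by (simp_all add: R_def)
  interpret KZ2: group KZ2 by (rule group_KZ2)
  define P where "P = presented_group R"
  interpret P: group P unfolding P_def by (rule group_presented_group)
  define A where "A = word_class R [Gen gens_B2.\<alpha>]"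
  define B where "B = word_class R [Gen gens_B2.\<beta>]"
  define C where "C = word_class R [Gen gens_B2.\<gamma>]"
  have closed: "A \<in> carrier P" "B \<in> carrier P" "C \<in> carrier P"
    by (simp_all add: A_def B_def C_def P_def)
  note rels = mem_R[THEN word_val_relation, unfolded word_val.simps letter_val.simps,
      folded A_def B_def C_def P_def]
  have CB: "C \<otimes>\<^bsub>P\<^esub> B = B \<otimes>\<^bsub>P\<^esub> C"
    using rels(1) closed P.inv_solve_right'[of B "C \<otimes>\<^bsub>P\<^esub> B" C] by (simp add: P.m_assoc)
  have BA: "B \<otimes>\<^bsub>P\<^esub> A = A \<otimes>\<^bsub>P\<^esub> inv\<^bsub>P\<^esub> B"
    using rels(3) closed by (intro P.conj_inv_swap) (simp_all add: P.m_assoc)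
  have "A \<otimes>\<^bsub>P\<^esub> C = B \<otimes>\<^bsub>P\<^esub> C \<otimes>\<^bsub>P\<^esub> A"
    using rels(2) closed P.inv_solve_right'[of B "A \<otimes>\<^bsub>P\<^esub> C \<otimes>\<^bsub>P\<^esub> inv\<^bsub>P\<^esub> A" C]
      P.inv_solve_right'[of "B \<otimes>\<^bsub>P\<^esub> C" "A \<otimes>\<^bsub>P\<^esub> C" A]
    by (simp add: P.m_assoc)
  \<comment> \<open>The relation for the commutator of \<open>A\<close> and \<open>C\<close> is
    multiplied by \<open>B\<close> on the right. In \<open>C B A B\<close> the factor
    \<open>B A\<close> becomes \<open>A\<close> times the inverse of \<open>B\<close>, which cancels
    the last \<open>B\<close> and leaves \<open>C A\<close>.\<close>
  then have "A \<otimes>\<^bsub>P\<^esub> (C \<otimes>\<^bsub>P\<^esub> B) = C \<otimes>\<^bsub>P\<^esub> B \<otimes>\<^bsub>P\<^esub> A \<otimes>\<^bsub>P\<^esub> B"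
    using closed P.m_assoc[of A C B] by (simp add: CB)
  then have "C \<otimes>\<^bsub>P\<^esub> A = A \<otimes>\<^bsub>P\<^esub> (C \<otimes>\<^bsub>P\<^esub> B)"
    using closed by (simp add: BA P.m_assoc)
  then have hom: "(\<lambda>(k, l, m). A [^]\<^bsub>P\<^esub> k \<otimes>\<^bsub>P\<^esub> (B [^]\<^bsub>P\<^esub> ((m - l) div 2) \<otimes>\<^bsub>P\<^esub> C [^]\<^bsub>P\<^esub> m)) \<in> hom KZ2 P"
    by (intro P.hom_from_KZ2 closed CB BA)
  define f where "f g = (case g of gens_B2.\<alpha> \<Rightarrow> (1, 0, 0) | gens_B2.\<beta> \<Rightarrow> (0, - 2, 0) |
    gens_B2.\<gamma> \<Rightarrow> (0 :: int, 1 :: int, 1 :: int))" for g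
  have "KZ2 \<cong> P"
  proof (rule KZ2.presented_group_iso[of f R, OF _ _ hom[unfolded P_def], folded P_def])
    have "f g \<in> carrier KZ2" for g by (cases g) (simp_all add: f_def)
    then show "range f \<subseteq> carrier KZ2" by blast
    show "word_val KZ2 f l = word_val KZ2 f r" if "(l, r) \<in> R" for l r
      using that by (auto simp: R_def f_def KZ2_inv)
    show "(case f g of (k, l, m) \<Rightarrow> A [^]\<^bsub>P\<^esub> k \<otimes>\<^bsub>P\<^esub> (B [^]\<^bsub>P\<^esub> ((m - l) div 2) \<otimes>\<^bsub>P\<^esub> C [^]\<^bsub>P\<^esub> m)) =
        word_class R [Gen g]" for g
      using closed by (cases g) (simp_all add: f_def flip: A_def B_def C_def)
    fix \<phi> u
    assume phi: "\<phi> \<in> hom P KZ2" "\<And>x. \<phi> (word_class R [Gen x]) = f x" and u: "u \<in> carrier KZ2"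
    interpret phi: group_hom P KZ2 \<phi> by unfold_locales (rule phi)
    have "\<phi> A = (1, 0, 0)" "\<phi> B = (0, - 2, 0)" "\<phi> C = (0, 1, 1)"
      by (simp_all add: A_def B_def C_def phi(2) f_def)
    then show "\<phi> (case u of (k, l, m) \<Rightarrow> A [^]\<^bsub>P\<^esub> k \<otimes>\<^bsub>P\<^esub> (B [^]\<^bsub>P\<^esub> ((m - l) div 2) \<otimes>\<^bsub>P\<^esub> C [^]\<^bsub>P\<^esub> m)) = u"
      using closed u by (cases u) (auto simp: phi.hom_int_pow KZ2_int_pow)
  qed
  then show ?thesis by (simp add: pi1_B2_def R_def P_def)
qed

subsection \<open>Isomorphism invariants\<close>

definition commutes :: "('a, 'm) monoid_scheme \<Rightarrow> bool"
  where "commutes G \<longleftrightarrow> (\<forall>g\<in>carrier G. \<forall>h\<in>carrier G. g \<otimes>\<^bsub>G\<^esub> h = h \<otimes>\<^bsub>G\<^esub> g)"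

text \<open>
  Distinguishes the two amphicosms: if \<open>g h g = h\<close>, i.e. \<open>h\<close> conjugates \<open>g\<close> to its inverse, then
  \<open>g\<close> is a commutator. In \<open>\<pi>\<^sub>1(B\<^sub>1)\<close> this fails for \<open>g = b\<close>.
\<close>

definition reversed_are_commutators :: "('a, 'm) monoid_scheme \<Rightarrow> bool"
  where "reversed_are_commutators G \<longleftrightarrow>
    (\<forall>g\<in>carrier G. \<forall>h\<in>carrier G. g \<otimes>\<^bsub>G\<^esub> h \<otimes>\<^bsub>G\<^esub> g = h \<longrightarrow>
      (\<exists>u\<in>carrier G. \<exists>v\<in>carrier G. u \<otimes>\<^bsub>G\<^esub> v = g \<otimes>\<^bsub>G\<^esub> v \<otimes>\<^bsub>G\<^esub> u))"

lemma commutes_iso: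
  assumes "group G" "G \<cong> H" "commutes G"
  shows "commutes H"
proof -
  interpret G: group G by (rule assms)
  obtain \<phi> where phi: "\<phi> \<in> hom G H" "\<phi> ` carrier G = carrier H"
    using assms(2) by (auto simp: is_iso_def iso_def bij_betw_def)
  show ?thesis
    using assms(3) unfolding commutes_def phi(2)[symmetric]
    by (simp flip: hom_mult[OF phi(1)])
qed

lemma reversed_are_commutators_iso:
  assumes "group G" "G \<cong> H" "reversed_are_commutators G"
  shows "reversed_are_commutators H"
proof -
  interpret G: group G by (rule assms)
  obtain \<phi> where phi: "\<phi> \<in> hom G H" "\<phi> ` carrier G = carrier H" "inj_on \<phi> (carrier G)"
    using assms(2) by (auto simp: is_iso_def iso_def bij_betw_def)
  show ?thesis
    using assms(3) unfolding reversed_are_commutators_def phi(2)[symmetric]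
    by (auto simp: inj_on_eq_iff[OF phi(3)] simp flip: hom_mult[OF phi(1)])
qed

lemma commutes_Z3: "commutes Z3"
  by (auto simp: commutes_def)

lemma not_commutes_KZ: "\<not> commutes KZ"
proof
  assume "commutes KZ"
  then have "(1, 0, 0) \<otimes>\<^bsub>KZ\<^esub> (0, 1, 0) = (0, 1, 0) \<otimes>\<^bsub>KZ\<^esub> (1, 0, 0)"
    unfolding commutes_def by (simp del: KZ_simps(2))
  then show False by simp
qed

lemma not_commutes_KZ2: "\<not> commutes KZ2"
proof
  assume "commutes KZ2"
  then have "(1, 0, 0) \<otimes>\<^bsub>KZ2\<^esub> (0, 2, 0) = (0, 2, 0) \<otimes>\<^bsub>KZ2\<^esub> (1, 0, 0)"
    unfolding commutes_def by (simp del: KZ2_simps(2))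
  then show False by simp
qed

lemma not_reversed_are_commutators_KZ: "\<not> reversed_are_commutators KZ"
proof
  assume "reversed_are_commutators KZ"
  moreover have "(0, 1, 0) \<otimes>\<^bsub>KZ\<^esub> (1, 0, 0) \<otimes>\<^bsub>KZ\<^esub> (0, 1, 0) = (1, 0, 0)" by simp
  ultimately have "\<exists>u\<in>carrier KZ. \<exists>v\<in>carrier KZ. u \<otimes>\<^bsub>KZ\<^esub> v = (0, 1, 0) \<otimes>\<^bsub>KZ\<^esub> v \<otimes>\<^bsub>KZ\<^esub> u"
    unfolding reversed_are_commutators_def by (metis UNIV_I KZ_simps(1))
  \<comment> \<open>Signs are invisible modulo 2: the middle coordinates of \<open>u v\<close> and
    \<open>v u\<close> have the same parity, but the factor \<open>(0, 1, 0)\<close> changes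
    it.\<close>
  then obtain u v where "u \<otimes>\<^bsub>KZ\<^esub> v = (0, 1, 0) \<otimes>\<^bsub>KZ\<^esub> v \<otimes>\<^bsub>KZ\<^esub> u" by blast
  then show False
    by (cases u; cases v; simp add: flip_def split: if_splits; presburger)
qed

lemma reversed_are_commutators_KZ2: "reversed_are_commutators KZ2"
  unfolding reversed_are_commutators_def
proof (intro ballI impI)
  fix g h assume gh: "g \<in> carrier KZ2" "h \<in> carrier KZ2" "g \<otimes>\<^bsub>KZ2\<^esub> h \<otimes>\<^bsub>KZ2\<^esub> g = h"
  \<comment> \<open>The outer coordinates of \<open>g\<close> count twice in
    \<open>g h g = h\<close>, so they vanish; membership in \<open>KZ2\<close> then makes the middle
    one even.\<close>
  obtain y where y: "g = (0, 2 * y, 0)"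
    using gh by (cases g; cases h; auto)
  \<comment> \<open>The witnesses are \<alpha> and \<gamma>^(-y): the commutator of \<alpha> and
    \<gamma> is \<beta> = \<open>(0, -2, 0)\<close>, so theirs is \<beta>^(-y) =
    \<open>g\<close>.\<close>
  have "(1, 0, 0) \<otimes>\<^bsub>KZ2\<^esub> (0, - y, - y) = g \<otimes>\<^bsub>KZ2\<^esub> (0, - y, - y) \<otimes>\<^bsub>KZ2\<^esub> (1, 0, 0)"
    by (simp add: y)
  then show "\<exists>u\<in>carrier KZ2. \<exists>v\<in>carrier KZ2. u \<otimes>\<^bsub>KZ2\<^esub> v = g \<otimes>\<^bsub>KZ2\<^esub> v \<otimes>\<^bsub>KZ2\<^esub> u"
    by (intro bexI[of _ "(1, 0, 0)"] bexI[of _ "(0, - y, - y)"]) simp_all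
qed

subsection \<open>Subgroups of finite index\<close>

lemma subgroups_of_index_iso:
  assumes G: "group G" and H: "group H" and phi: "\<phi> \<in> iso G H"
    and D: "D \<in> subgroups_of_index G n"
  shows "\<phi> ` D \<in> subgroups_of_index H n" "G\<lparr>carrier := D\<rparr> \<cong> H\<lparr>carrier := \<phi> ` D\<rparr>"
proof -
  have bij: "bij_betw \<phi> (carrier G) (carrier H)" and "\<phi> \<in> hom G H"
    using phi by (auto simp: iso_def)
  then interpret phi: group_hom G H \<phi>
    using G H by (simp add: group_hom_def group_hom_axioms_def)
  have sub: "subgroup D G" and index: "card (rcosets\<^bsub>G\<^esub> D) = n"
    using D by (auto simp: subgroups_of_index_def)
  have "D \<subseteq> carrier G" using sub by (rule subgroup.subset)
  have coset: "\<phi> ` D #>\<^bsub>H\<^esub> \<phi> g = \<phi> ` (D #>\<^bsub>G\<^esub> g)" if "g \<in> carrier G" for g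
    using that \<open>D \<subseteq> carrier G\<close> by (auto simp: r_coset_def subset_iff image_UN)
  have "rcosets\<^bsub>H\<^esub> (\<phi> ` D) = (\<lambda>C. \<phi> ` C) ` (rcosets\<^bsub>G\<^esub> D)"
    unfolding RCOSETS_def bij_betw_imp_surj_on[OF bij, symmetric] by (auto simp: coset)
  \<comment> \<open>Cosets are subsets of the carrier, where taking images under an injective map is
    injective.\<close>
  moreover have "inj_on (\<lambda>C. \<phi> ` C) (rcosets\<^bsub>G\<^esub> D)"
    by (rule inj_on_subset[OF inj_on_image_Pow[OF bij_betw_imp_inj_on[OF bij]]])
      (use G \<open>D \<subseteq> carrier G\<close> in \<open>auto simp: RCOSETS_def dest: phi.G.r_coset_subset_G[THEN subsetD]\<close>)
  ultimately show "\<phi> ` D \<in> subgroups_of_index H n"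
    using index phi.subgroup_img_is_subgroup[OF sub]
    by (simp add: subgroups_of_index_def card_image)
  show "G\<lparr>carrier := D\<rparr> \<cong> H\<lparr>carrier := \<phi> ` D\<rparr>"
  proof (rule is_isoI[of _ \<phi>])
    show "inj_on \<phi> (carrier (G\<lparr>carrier := D\<rparr>))"
      using inj_on_subset[OF bij_betw_imp_inj_on[OF bij] \<open>D \<subseteq> carrier G\<close>] by simp
  qed (use \<open>D \<subseteq> carrier G\<close> in \<open>simp_all add: subset_iff\<close>)
qed

lemma subgroups_of_index_bij:
  assumes G: "group G" and H: "group H" and phi: "\<phi> \<in> iso G H"
  shows "bij_betw (\<lambda>D. \<phi> ` D) (subgroups_of_index G n) (subgroups_of_index H n)"
proof -
  have bij: "bij_betw \<phi> (carrier G) (carrier H)"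
    using phi by (auto simp: iso_def)
  have psi: "inv_into (carrier G) \<phi> \<in> iso H G"
    using G phi by (rule group.iso_set_sym)
  have carr: "subgroups_of_index G' n \<subseteq> Pow (carrier G')" for G' :: "'c monoid" and n
    by (auto simp: subgroups_of_index_def dest: subgroup.subset)
  show ?thesis
  proof (rule bij_betwI[where g = "\<lambda>D. inv_into (carrier G) \<phi> ` D"])
    show "inv_into (carrier G) \<phi> ` \<phi> ` D = D" if "D \<in> subgroups_of_index G n" for D
      using that carr[of G n] bij_betw_imp_inj_on[OF bij] by (intro inv_into_image_cancel) auto
    show "\<phi> ` inv_into (carrier G) \<phi> ` D = D" if "D \<in> subgroups_of_index H n" for D
      using that carr[of H n] bij_betw_imp_surj_on[OF bij] by (intro image_inv_into_cancel) auto
  qed (use subgroups_of_index_iso[OF G H phi] subgroups_of_index_iso[OF H G psi] in auto)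
qed

lemma (in group) card_rcosets_transversal:
  assumes "subgroup D G" "T \<subseteq> carrier G"
    and ex: "\<And>g. g \<in> carrier G \<Longrightarrow> \<exists>r\<in>T. g \<in> D #> r"
    and uniq: "\<And>r r'. r \<in> T \<Longrightarrow> r' \<in> T \<Longrightarrow> r \<in> D #> r' \<Longrightarrow> r = r'"
  shows "card (rcosets D) = card T"
proof -
  have "bij_betw (\<lambda>r. D #> r) T (rcosets D)"
    unfolding bij_betw_def
  proof (intro conjI equalityI subsetI)
    show "inj_on ((#>) D) T"
      by (rule inj_onI) (metis assms(1,2) rcos_self subsetD uniq)
    fix C assume "C \<in> rcosets D"
    then obtain g where g: "g \<in> carrier G" "C = D #> g" by (auto simp: RCOSETS_def)
    with ex obtain r where "r \<in> T" "g \<in> D #> r" by blast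
    with g show "C \<in> (\<lambda>r. D #> r) ` T"
      using assms(1,2) repr_independence[of g D r] by auto
  qed (use assms(2) in \<open>auto simp: RCOSETS_def\<close>)
  then show ?thesis by (simp add: bij_betw_same_card)
qed

text \<open>Pigeonhole: infinitely many indices share finitely many cosets. Along a coordinate axis
  this puts a nontrivial element of the axis into \<open>D\<close>.\<close>

lemma (in group) finite_index_meets:
  fixes u :: "nat \<Rightarrow> 'a"
  assumes "subgroup D G" "finite (rcosets D)" "range u \<subseteq> carrier G"
  obtains i j where "i < j" "u j \<otimes> inv u i \<in> D"
proof -
  have u: "u i \<in> carrier G" for i using assms(3) by auto
  then have "range (\<lambda>i. D #> u i) \<subseteq> rcosets D"
    using assms(3) by (auto simp: RCOSETS_def)
  then have "\<not> inj (\<lambda>i. D #> u i)"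
    using assms(2) finite_imageD finite_subset infinite_UNIV_nat by blast
  then obtain i j where "i < j" "D #> u i = D #> u j"
    unfolding inj_def by (metis nat_neq_iff)
  moreover have "u j \<in> D #> u i"
    using calculation(2) rcos_self[OF _ assms(1), of "u j"] u by auto
  ultimately show ?thesis
    using that subgroup.rcos_module_imp[OF assms(1) is_group, of "u i" "u j"] u by auto
qed

text \<open>Division with remainder by the least positive element of \<open>S\<close>. Closure under
  differences is what the projections of a subgroup of \<open>KZ\<close> supply.\<close>

lemma int_subgroup_multiples:
  fixes S :: "int set"
  assumes diff: "\<And>x y. x \<in> S \<Longrightarrow> y \<in> S \<Longrightarrow> x - y \<in> S" and "m \<in> S" "m > 0"
  obtains d where "d > 0" "\<And>x. x \<in> S \<longleftrightarrow> d dvd x"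
proof -
  define d where "d = (LEAST i. 0 < i \<and> int i \<in> S)"
  have d: "0 < d \<and> int d \<in> S"
    unfolding d_def by (rule LeastI[of _ "nat m"]) (use assms in simp)
  have least: "\<not> (0 < i \<and> int i \<in> S)" if "i < d" for i
    using that unfolding d_def by (rule not_less_Least)
  have "0 \<in> S" using diff[OF assms(2,2)] by simp
  then have "- x \<in> S" if "x \<in> S" for x using diff[of 0 x] that by simp
  then have add: "x + y \<in> S" if "x \<in> S" "y \<in> S" for x y
    using diff[of x "- y"] that by simp
  have mult: "int d * j \<in> S" for j
  proof (induction j rule: int_step_induct)
    case (2 j)
    with add[of "int d * j" "int d"] d show ?case by (simp add: distrib_left)
  next
    case (3 j)
    with diff[of "int d * j" "int d"] d show ?case by (simp add: right_diff_distrib)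
  qed (use \<open>0 \<in> S\<close> in simp)
  have "x \<in> S \<longleftrightarrow> int d dvd x" for x
  proof
    assume "x \<in> S"
    then have "int (nat (x mod int d)) \<in> S"
      using diff[OF _ mult[of "x div int d"], of x] d by (simp add: minus_mult_div_eq_mod)
    moreover have "nat (x mod int d) < d" using d by (simp add: nat_less_iff)
    ultimately have "\<not> 0 < nat (x mod int d)"
      using least by metis
    moreover have "0 \<le> x mod int d" using d by simp
    ultimately show "int d dvd x" by (simp add: dvd_eq_mod_eq_0)
  next
    assume "int d dvd x"
    then obtain j where "x = int d * j" ..
    then show "x \<in> S" using mult by simp
  qed
  with d show thesis by (intro that[of "int d"]) simp_all
qed

lemma is_iso_image:
  assumes "group G" "h \<in> hom G H" "inj_on h (carrier G)"
  shows "H\<lparr>carrier := h ` carrier G\<rparr> \<cong> G"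
proof -
  have "G \<cong> H\<lparr>carrier := h ` carrier G\<rparr>"
    by (rule is_isoI[of _ h]) (use assms hom_mult[OF assms(2)] in simp_all)
  then show ?thesis by (rule group.iso_sym[OF assms(1)])
qed

subsection \<open>Normal forms of subgroups\<close>

text \<open>
  The set of products \<open>U\<^sup>s V\<^sup>t B\<^sup>w\<close> with \<open>U = (d, q, e)\<close>, \<open>V = (0, p, f)\<close> and \<open>B = (0, k, 0)\<close>; for odd \<open>d\<close> the
  square of \<open>U\<close> has middle coordinate \<open>0\<close>. It is a subgroup if \<open>d\<close> is even or \<open>k\<close> divides \<open>2 p\<close>.
\<close>

definition lat :: "int \<Rightarrow> int \<Rightarrow> int \<Rightarrow> int \<Rightarrow> int \<Rightarrow> int \<Rightarrow> (int \<times> int \<times> int) set"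
  where "lat d f k e p q =
    {(d * s, (if even d then s else s mod 2) * q + p * t + k * w, e * s + f * t) | s t w. True}"

lemma lat_member:
  "(d * s, (if even d then s else s mod 2) * q + p * t + k * w, e * s + f * t) \<in> lat d f k e p q"
  unfolding lat_def by blast

text \<open>All first coordinates are multiples of an even \<open>d\<close>, so every sign is
  trivial and the product is coordinatewise addition: \<open>\<psi>\<close> embeds
  \<open>Z3\<close>.\<close>

lemma lat_even:
  assumes "even d" "d \<noteq> 0" "f \<noteq> 0" "k \<noteq> 0"
  shows "subgroup (lat d f k e p q) KZ" "KZ\<lparr>carrier := lat d f k e p q\<rparr> \<cong> Z3"
proof -
  define \<psi> where "\<psi> = (\<lambda>(s, t, w). (d * s, s * q + p * t + k * w, e * s + f * t))"
  have hom: "\<psi> \<in> hom Z3 KZ"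
    using assms(1) by (auto simp: hom_def \<psi>_def flip_def algebra_simps)
  have img: "\<psi> ` carrier Z3 = lat d f k e p q"
  proof (intro equalityI subsetI)
    fix u assume "u \<in> \<psi> ` carrier Z3"
    then obtain s t w where "u = \<psi> (s, t, w)" by auto
    then show "u \<in> lat d f k e p q"
      using lat_member[of d s q p t k w e f] assms(1) by (simp add: \<psi>_def)
  next
    fix u assume "u \<in> lat d f k e p q"
    then obtain s t w where "u = \<psi> (s, t, w)"
      using assms(1) by (auto simp: lat_def \<psi>_def)
    then show "u \<in> \<psi> ` carrier Z3" by simp
  qed
  interpret psi: group_hom Z3 KZ \<psi>
    using hom group_Z3 group_KZ by (simp add: group_hom_def group_hom_axioms_def)
  show "subgroup (lat d f k e p q) KZ"
    using psi.img_is_subgroup unfolding img .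
  have "inj \<psi>" using assms(2-) by (auto simp: inj_def \<psi>_def)
  then show "KZ\<lparr>carrier := lat d f k e p q\<rparr> \<cong> Z3"
    using is_iso_image[OF group_Z3 hom] unfolding img by simp
qed

text \<open>This endomorphism sends \<open>(1, 0, 0)\<close>, \<open>(0, 1, 0)\<close>,
  \<open>(0, 0, 1)\<close> to \<open>(d, q, e)\<close>, \<open>(0, h, 0)\<close>,
  \<open>(0, 0, f)\<close>. It serves both odd cases, with \<open>h = k\<close> on \<open>KZ\<close>
  and with \<open>h = p\<close> on \<open>KZ2\<close>.\<close>

lemma flip_odd_embedding_hom:
  assumes "odd d"
  shows "(\<lambda>(x, y, z). (d * x, x mod 2 * q + h * y, e * x + f * z)) \<in> hom KZ KZ"
    and "f \<noteq> 0 \<Longrightarrow> h \<noteq> 0 \<Longrightarrow> inj (\<lambda>(x, y, z). (d * x, x mod 2 * q + h * y, e * x + f * z))"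
proof -
  \<comment> \<open>For odd \<open>d\<close> the middle coordinate of the powers of
    \<open>(d, q, e)\<close> alternates between \<open>0\<close> and \<open>q\<close>; two odd
    exponents contribute \<open>- q + q\<close>.\<close>
  have "(x + x') mod 2 * q = flip (d * x') (x mod 2 * q) + x' mod 2 * q" for x x'
  proof (cases "even x")
    case True
    then show ?thesis by (simp add: mod_add_left_eq[of x 2 x', symmetric] even_iff_mod_2_eq_zero[THEN iffD1])
  next
    case False
    then show ?thesis
      using assms by (cases "even x'") (simp_all add: flip_def odd_iff_mod_2_eq_one[THEN iffD1] even_iff_mod_2_eq_zero[THEN iffD1])
  qed
  then show "(\<lambda>(x, y, z). (d * x, x mod 2 * q + h * y, e * x + f * z)) \<in> hom KZ KZ"
    using assms by (auto simp: hom_def flip_def algebra_simps)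
  show "inj (\<lambda>(x, y, z). (d * x, x mod 2 * q + h * y, e * x + f * z))"
    if "f \<noteq> 0" "h \<noteq> 0"
    using that assms by (auto simp: inj_def)
qed

lemma lat_odd_KZ:
  assumes "odd d" "f \<noteq> 0" "k \<noteq> 0"
  shows "subgroup (lat d f k e 0 q) KZ" "KZ\<lparr>carrier := lat d f k e 0 q\<rparr> \<cong> KZ"
proof -
  define \<psi> where "\<psi> = (\<lambda>(x, y, z). (d * x, x mod 2 * q + k * y, e * x + f * z))"
  have hom: "\<psi> \<in> hom KZ KZ" and inj: "inj \<psi>"
    using assms flip_odd_embedding_hom[OF assms(1)] by (auto simp: \<psi>_def)
  have img: "\<psi> ` carrier KZ = lat d f k e 0 q"
  proof (intro equalityI subsetI)
    fix u assume "u \<in> \<psi> ` carrier KZ"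
    then obtain x y z where "u = \<psi> (x, y, z)" by auto
    then show "u \<in> lat d f k e 0 q"
      using lat_member[of d x q 0 z k y e f] assms(1) by (simp add: \<psi>_def)
  next
    fix u assume "u \<in> lat d f k e 0 q"
    then obtain s t w where "u = \<psi> (s, w, t)"
      using assms(1) by (auto simp: lat_def \<psi>_def)
    then show "u \<in> \<psi> ` carrier KZ" by simp
  qed
  interpret psi: group_hom KZ KZ \<psi>
    using hom group_KZ by (simp add: group_hom_def group_hom_axioms_def)
  show "subgroup (lat d f k e 0 q) KZ"
    using psi.img_is_subgroup unfolding img .
  show "KZ\<lparr>carrier := lat d f k e 0 q\<rparr> \<cong> KZ"
    using is_iso_image[OF group_KZ hom] inj unfolding img by simp
qed

text \<open>Under the embedding with \<open>h = p\<close> the elements \<open>(1, 0, 0)\<close>,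
  \<open>(0, 1, 1)\<close>, \<open>(0, 2, 0)\<close> of \<open>KZ2\<close> go to the generators
  \<open>(d, q, e)\<close>, \<open>(0, p, f)\<close>, \<open>(0, 2 * p, 0)\<close>.\<close>

lemma lat_odd_KZ2:
  assumes "odd d" "f \<noteq> 0" "p \<noteq> 0"
  shows "subgroup (lat d f (2 * p) e p q) KZ" "KZ\<lparr>carrier := lat d f (2 * p) e p q\<rparr> \<cong> KZ2"
proof -
  define \<psi> where "\<psi> = (\<lambda>(x, y, z). (d * x, x mod 2 * q + p * y, e * x + f * z))"
  have hom: "\<psi> \<in> hom KZ KZ" and inj: "inj \<psi>"
    using assms flip_odd_embedding_hom[OF assms(1)] by (auto simp: \<psi>_def)
  have img: "\<psi> ` carrier KZ2 = lat d f (2 * p) e p q"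
  proof (intro equalityI subsetI)
    fix u assume "u \<in> \<psi> ` carrier KZ2"
    then obtain x y z where u: "u = \<psi> (x, y, z)" and "even (y + z)" by auto
    then obtain w where "y = z + 2 * w"
      by (metis dvdE even_diff_iff diff_add_cancel add.commute even_add)
    then show "u \<in> lat d f (2 * p) e p q"
      using lat_member[of d x q p z "2 * p" w e f] assms(1) by (simp add: u \<psi>_def algebra_simps)
  next
    fix u assume "u \<in> lat d f (2 * p) e p q"
    then obtain s t w where "u = (d * s, s mod 2 * q + p * t + 2 * p * w, e * s + f * t)"
      using assms(1) by (auto simp: lat_def)
    then have "u = \<psi> (s, t + 2 * w, t)" by (simp add: \<psi>_def algebra_simps)
    then show "u \<in> \<psi> ` carrier KZ2" by (rule image_eqI) simp
  qed
  interpret psi: group_hom KZ KZ \<psi>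
    using hom group_KZ by (simp add: group_hom_def group_hom_axioms_def)
  show "subgroup (lat d f (2 * p) e p q) KZ"
    using psi.subgroup_img_is_subgroup[OF subgroup_KZ2] by (simp only: img)
  have hom2: "\<psi> \<in> hom KZ2 KZ"
    using hom unfolding hom_def KZ2_def by simp
  show "KZ\<lparr>carrier := lat d f (2 * p) e p q\<rparr> \<cong> KZ2"
    using is_iso_image[OF group_KZ2 hom2] inj_on_subset[OF inj subset_UNIV] unfolding img by simp
qed

definition admissible :: "int \<Rightarrow> int \<Rightarrow> int \<Rightarrow> int \<Rightarrow> int \<Rightarrow> int \<Rightarrow> bool"
  where "admissible d f k e p q \<longleftrightarrow>
    0 < d \<and> 0 < f \<and> 0 < k \<and> 0 \<le> e \<and> e < f \<and> 0 \<le> p \<and> p < k \<and> 0 \<le> q \<and> q < k \<and>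
    (even d \<or> k dvd 2 * p)"

text \<open>For odd \<open>d\<close> the number \<open>2 * p\<close> is a multiple of
  \<open>k\<close> with \<open>0 \<le> 2 * p < 2 * k\<close>, hence \<open>0\<close> or
  \<open>k\<close>.\<close>

lemma admissible_cases:
  assumes "admissible d f k e p q"
  obtains "even d" | "odd d" "p = 0" | "odd d" "p > 0" "k = 2 * p"
proof -
  have "p = 0 \<or> k = 2 * p" if "odd d"
  proof -
    from that assms obtain m where m: "2 * p = k * m" by (auto simp: admissible_def)
    have "0 \<le> k * m" "k * m < k * 2" "0 < k"
      using assms unfolding admissible_def m[symmetric] by linarith+
    then have "0 \<le> m" "m < 2" by (simp_all add: zero_le_mult_iff mult_less_cancel_left_pos)
    then have "m = 0 \<or> m = 1" by auto
    with m show ?thesis by auto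
  qed
  then show thesis using that assms by (cases "p = 0") (auto simp: admissible_def)
qed

lemma subgroup_lat:
  assumes "admissible d f k e p q"
  shows "subgroup (lat d f k e p q) KZ"
proof -
  have "d \<noteq> 0" "f \<noteq> 0" "k \<noteq> 0" using assms by (auto simp: admissible_def)
  with assms show ?thesis
    by (elim admissible_cases) (simp_all add: lat_even(1) lat_odd_KZ(1) lat_odd_KZ2(1))
qed

lemma lat_generators:
  "(d, q, e) \<in> lat d f k e p q" "(0, p, f) \<in> lat d f k e p q" "(0, k, 0) \<in> lat d f k e p q"
  using lat_member[of d 1 q p 0 k 0 e f] lat_member[of d 0 q p 1 k 0 e f]
    lat_member[of d 0 q p 0 k 1 e f] by (cases "even d"; simp)+

lemma mod_transversal_unique:
  fixes x x' m :: int
  assumes "x = m * s + x'" "x \<in> {0..<m}" "x' \<in> {0..<m}"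
  shows "s = 0"
proof -
  have "x mod m = x' mod m" using assms(1) by simp
  then have "x = x'" using assms(2,3) by simp
  then show ?thesis using assms by auto
qed

text \<open>The box of triples reduced modulo \<open>d\<close>, \<open>k\<close>, \<open>f\<close>
  is a transversal: the first coordinate is reduced by U, then the third by V, then the middle one
  by B.\<close>

lemma card_rcosets_lat:
  assumes "admissible d f k e p q"
  shows "card (rcosets\<^bsub>KZ\<^esub> (lat d f k e p q)) = nat d * (nat k * nat f)"
proof -
  have pos: "d > 0" "f > 0" "k > 0" using assms by (auto simp: admissible_def)
  interpret KZ: group KZ by (rule group_KZ)
  have "card (rcosets\<^bsub>KZ\<^esub> (lat d f k e p q)) = card ({0..<d} \<times> {0..<k} \<times> {0..<f})"
  proof (rule KZ.card_rcosets_transversal[OF subgroup_lat[OF assms]])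
    fix g :: "int \<times> int \<times> int"
    obtain x y z where g: "g = (x, y, z)" by (cases g)
    define s where "s = x div d"
    define t where "t = (z - e * s) div f"
    define v where "v = (if even d then s else s mod 2) * q + p * t"
    define y' where "y' = y - flip (x mod d) v"
    \<comment> \<open>Multiplying by a representative with odd first coordinate flips the middle
      coordinate, so the quotient by \<open>k\<close> is flipped beforehand.\<close>
    define w where "w = flip (x mod d) (y' div k)"
    have "flip (x mod d) (v + k * w) = flip (x mod d) v + k * (y' div k)"
      by (simp add: w_def flip_def)
    then have "flip (x mod d) (v + k * w) + y' mod k = flip (x mod d) v + y'"
      by (metis add.assoc mult_div_mod_eq)
    then have "y = flip (x mod d) (v + k * w) + y' mod k"
      by (simp add: y'_def)
    moreover have "x = d * s + x mod d" "z = e * s + f * t + (z - e * s) mod f"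
      by (simp_all add: s_def t_def)
    ultimately have "g = (d * s, v + k * w, e * s + f * t) \<otimes>\<^bsub>KZ\<^esub> (x mod d, y' mod k, (z - e * s) mod f)"
      using assms unfolding g KZ_simps(2) by (simp add: flip_def)
    moreover have "(d * s, v + k * w, e * s + f * t) \<in> lat d f k e p q"
      unfolding v_def by (rule lat_member)
    ultimately have "g \<in> lat d f k e p q #>\<^bsub>KZ\<^esub> (x mod d, y' mod k, (z - e * s) mod f)"
      unfolding r_coset_def by (metis UN_I singletonI)
    then show "\<exists>r\<in>{0..<d} \<times> {0..<k} \<times> {0..<f}. g \<in> lat d f k e p q #>\<^bsub>KZ\<^esub> r"
      by (rule bexI) (use pos in simp)
  next
    fix r r' assume r: "r \<in> {0..<d} \<times> {0..<k} \<times> {0..<f}" "r' \<in> {0..<d} \<times> {0..<k} \<times> {0..<f}"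
      and coset: "r \<in> lat d f k e p q #>\<^bsub>KZ\<^esub> r'"
    obtain x y z x' y' z' where xyz: "r = (x, y, z)" "r' = (x', y', z')" by (cases r; cases r')
    obtain u where "u \<in> lat d f k e p q" and u: "(x, y, z) = u \<otimes>\<^bsub>KZ\<^esub> (x', y', z')"
      using coset unfolding xyz r_coset_def by blast
    then obtain s t w where
      "u = (d * s, (if even d then s else s mod 2) * q + p * t + k * w, e * s + f * t)"
      unfolding lat_def by blast
    note eq = u[unfolded this KZ_simps]
    have s: "s = 0"
      by (rule mod_transversal_unique[of x d s x']) (use eq r xyz in auto)
    have t: "t = 0"
      by (rule mod_transversal_unique[of z f t z']) (use eq r xyz s in auto)
    have "flip x' w = 0"
      by (rule mod_transversal_unique[of y k _ y']) (use eq r xyz s t in \<open>auto simp: flip_def\<close>)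
    then have "w = 0" by (simp add: flip_def split: if_splits)
    with s t eq xyz show "r = r'" by simp
  qed simp
  then show ?thesis by (simp add: card_cartesian_product)
qed

text \<open>Inclusion of such subgroups forces divisibility of the pivots, so equality makes the
  pivots equal. The remaining entries are then congruent and reduced, hence equal.\<close>

lemma lat_inj:
  assumes "admissible d f k e p q" "admissible d' f' k' e' p' q'"
    and eq: "lat d f k e p q = lat d' f' k' e' p' q'"
  shows "(d, f, k, e, p, q) = (d', f', k', e', p', q')"
proof -
  have dvd: "d' dvd d \<and> f' dvd f \<and> k' dvd k"
    if "admissible d f k e p q" "admissible d' f' k' e' p' q'"
      and "lat d f k e p q \<subseteq> lat d' f' k' e' p' q'" for d f k e p q d' f' k' e' p' q'
  proof -
    have pos: "d' > 0" "f' > 0" using that by (auto simp: admissible_def)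
    have "(d, q, e) \<in> lat d' f' k' e' p' q'" "(0, p, f) \<in> lat d' f' k' e' p' q'"
      "(0, k, 0) \<in> lat d' f' k' e' p' q'"
      using that(3) lat_generators by blast+
    then show ?thesis using pos by (auto simp: lat_def)
  qed
  have pos: "d > 0" "f > 0" "k > 0" "d' > 0" "f' > 0" "k' > 0"
    using assms by (auto simp: admissible_def)
  have same: "d' = d" "f' = f" "k' = k"
    using dvd[OF assms(1,2)] dvd[OF assms(2,1)] eq pos by (auto intro: zdvd_antisym_nonneg)
  have mem: "(d, q, e) \<in> lat d f k e' p' q'" "(0, p, f) \<in> lat d f k e' p' q'"
    using eq lat_generators(1)[of d q e f k p] lat_generators(2)[of p f d k e q]
    by (simp_all add: same)
  obtain w where "p = k * w + p'"
    using mem(2) pos by (auto simp: lat_def)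
  with mod_transversal_unique[OF this] assms have p: "p = p'"
    by (auto simp: admissible_def same)
  obtain t w where t: "e = f * t + e'" and q: "q = q' + p' * t + k * w"
    using mem(1) pos by (auto simp: lat_def)
  have "t = 0" using mod_transversal_unique[OF t] assms by (auto simp: admissible_def same)
  with q have "q = k * w + q'" by simp
  with mod_transversal_unique[OF this] assms have "q = q'"
    by (auto simp: admissible_def same)
  with \<open>t = 0\<close> t p same show ?thesis by simp
qed

text \<open>Row reduction: \<open>d\<close> generates the first coordinates of \<open>D\<close>,
  \<open>f\<close> the third coordinates where the first is \<open>0\<close>, and \<open>k\<close>
  the middle coordinates where both others are \<open>0\<close>. Finite index makes all three
  positive.\<close>

lemma lat_exhausts:
  assumes sub: "subgroup D KZ" and fin: "finite (rcosets\<^bsub>KZ\<^esub> D)"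
  obtains d f k e p q where "admissible d f k e p q" "D = lat d f k e p q"
proof -
  interpret KZ: group KZ by (rule group_KZ)
  interpret D: subgroup D KZ by (rule sub)
  note D_mult = D.m_closed[of "(x, y, z)" "(x', y', z')" for x y z x' y' z', unfolded KZ_simps]
  note D_inv = D.m_inv_closed[of "(x, y, z)" for x y z, unfolded inv_KZ]
  note D_one = D.one_closed[unfolded KZ_simps]
  \<comment> \<open>The quotient of two elements, which plays the role of subtracting rows.\<close>
  have D_diff: "(x - x', flip x' (y - y'), z - z') \<in> D" if "(x, y, z) \<in> D" "(x', y', z') \<in> D" for x y z x' y' z'
    using D_mult[OF that(1) D_inv[OF that(2)]] by (simp add: flip_def split: if_splits)
  obtain i j :: nat where "i < j" "(int j, 0, 0) \<otimes>\<^bsub>KZ\<^esub> inv\<^bsub>KZ\<^esub> (int i, 0, 0) \<in> D"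
    using KZ.finite_index_meets[OF sub fin, of "\<lambda>i. (int i, 0, 0)"] by auto
  then have x_mem: "(int (j - i), 0, 0) \<in> D" and x_pos: "int (j - i) > 0"
    by (simp_all add: of_nat_diff)
  obtain i' j' :: nat where "i' < j'" "(0, 0, int j') \<otimes>\<^bsub>KZ\<^esub> inv\<^bsub>KZ\<^esub> (0, 0, int i') \<in> D"
    using KZ.finite_index_meets[OF sub fin, of "\<lambda>i. (0, 0, int i)"] by auto
  then have z_mem: "(0, 0, int (j' - i')) \<in> D" and z_pos: "int (j' - i') > 0"
    by (simp_all add: of_nat_diff)
  obtain i'' j'' :: nat where "i'' < j''" "(0, int j'', 0) \<otimes>\<^bsub>KZ\<^esub> inv\<^bsub>KZ\<^esub> (0, int i'', 0) \<in> D"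
    using KZ.finite_index_meets[OF sub fin, of "\<lambda>i. (0, int i, 0)"] by auto
  then have y_mem: "(0, int (j'' - i''), 0) \<in> D" and y_pos: "int (j'' - i'') > 0"
    by (simp_all add: of_nat_diff)
  obtain d where d: "d > 0" "\<And>x. (\<exists>y z. (x, y, z) \<in> D) \<longleftrightarrow> d dvd x"
    by (rule int_subgroup_multiples[of "{x. \<exists>y z. (x, y, z) \<in> D}" "int (j - i)"])
      (use x_mem x_pos D_diff in blast)+
  obtain f where f: "f > 0" "\<And>z. (\<exists>y. (0, y, z) \<in> D) \<longleftrightarrow> f dvd z"
    by (rule int_subgroup_multiples[of "{z. \<exists>y. (0, y, z) \<in> D}" "int (j' - i')"])
      (use z_mem z_pos D_diff[of 0 _ _ 0] in \<open>simp_all, blast+\<close>)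
  obtain k where k: "k > 0" "\<And>y. (0, y, 0) \<in> D \<longleftrightarrow> k dvd y"
    by (rule int_subgroup_multiples[of "{y. (0, y, 0) \<in> D}" "int (j'' - i'')"])
      (use y_mem y_pos D_diff[of 0 _ 0 0 _ 0] in simp_all)
  have k_mem: "(0, k * w, 0) \<in> D" for w by (simp add: k(2))
  obtain p0 where p0: "(0, p0, f) \<in> D" using f(2)[of "f"] by auto
  define p where "p = p0 mod k"
  have p: "(0, p, f) \<in> D"
    using D_diff[OF p0 k_mem[of "p0 div k"]] by (simp add: p_def minus_mult_div_eq_mod)
  have pf_mem: "(0, p * t, f * t) \<in> D" for t
  proof (induction t rule: int_step_induct)
    case (2 t)
    from D_mult[OF 2 p] show ?case by (simp add: algebra_simps)
  next
    case (3 t)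
    from D_diff[OF 3 p] show ?case by (simp add: algebra_simps)
  qed (use D_one in simp)
  obtain q0 e0 where e0: "(d, q0, e0) \<in> D" using d(2)[of "d"] by auto
  \<comment> \<open>Subtracting multiples of V changes the middle coordinate, so \<open>e\<close> is
    reduced before \<open>q\<close>.\<close>
  define e where "e = e0 mod f"
  obtain q1 where q1: "(d, q1, e) \<in> D"
    using D_diff[OF e0 pf_mem[of "e0 div f"]] by (auto simp: e_def minus_mult_div_eq_mod)
  define q where "q = q1 mod k"
  have q: "(d, q, e) \<in> D"
    using D_diff[OF q1 k_mem[of "q1 div k"]] by (simp add: q_def minus_mult_div_eq_mod)
  \<comment> \<open>For odd \<open>d\<close> the products U V and V U have middle coordinates
    \<open>q + p\<close> and \<open>q - p\<close>, so their quotient is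
    \<open>(0, - 2 * p, 0)\<close>.\<close>
  have commutator: "k dvd 2 * p" if "odd d"
    using D_diff[OF D_mult[OF q p] D_mult[OF p q]] that k(2)[of "- 2 * p"] by (simp add: flip_def k(2))
  have adm: "admissible d f k e p q"
    using d(1) f(1) k(1) commutator by (auto simp: admissible_def e_def p_def q_def)
  have parity: "(s + 1) mod 2 = 1 - s mod 2" "(s - 1) mod 2 = 1 - s mod 2" for s :: int
    by presburger+
  have q_mem: "(d * s, (if even d then s else s mod 2) * q, e * s) \<in> D" for s
  proof (induction s rule: int_step_induct)
    case (2 s)
    show ?case using D_mult[OF 2 q]
      by (cases "even s") (simp_all add: parity ring_distribs flip_def mod_2_eq_odd split: if_splits)
  next
    case (3 s)
    show ?case using D_diff[OF 3 q]
      by (cases "even s") (simp_all add: parity ring_distribs flip_def mod_2_eq_odd split: if_splits)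
  qed (use D_one in simp)
  have "lat d f k e p q \<subseteq> D"
  proof
    fix u assume "u \<in> lat d f k e p q"
    then obtain s t w where u: "u = (d * s, (if even d then s else s mod 2) * q + p * t + k * w, e * s + f * t)"
      by (auto simp: lat_def)
    show "u \<in> D"
      using D_mult[OF D_mult[OF q_mem[of s] pf_mem[of t]] k_mem[of w]] by (simp add: u)
  qed
  moreover have "u \<in> lat d f k e p q" if uD: "u \<in> D" for u
  proof -
    obtain x y z where u: "u = (x, y, z)" by (cases u)
    obtain s where s: "x = d * s" using d(2)[of x] uD u by auto
    define v where "v = (if even d then s else s mod 2) * q"
    have 1: "(0, flip x (y - v), z - e * s) \<in> D"
      using D_diff[OF uD[unfolded u] q_mem[of s, folded v_def]] by (simp add: s)
    then obtain t where t: "z - e * s = f * t" using f(2)[of "z - e * s"] by auto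
    have "(0, flip x (y - v) - p * t, 0) \<in> D"
      using D_diff[OF 1 pf_mem[of t]] by (simp add: t)
    then obtain w where w: "flip x (y - v) - p * t = k * w" using k(2) by auto
    \<comment> \<open>For odd \<open>x\<close> the term \<open>p * t\<close> comes out with the
      wrong sign; as \<open>k\<close> divides \<open>2 * p\<close>, this only changes the multiple
      of \<open>k\<close>.\<close>
    obtain w' where w': "y - v = p * t + k * w'"
    proof (cases "even x")
      case True
      with w have "y - v = p * t + k * w" by (simp add: flip_def)
      then show ?thesis by (rule that)
    next
      case False
      then obtain m where "2 * p = k * m" using commutator s by auto
      then have "2 * p * t = k * m * t" by simp
      with False w have "y - v = p * t + k * (- w - m * t)" by (auto simp: flip_def algebra_simps)
      then show ?thesis by (rule that)
    qed
    have "u = (d * s, (if even d then s else s mod 2) * q + p * t + k * w', e * s + f * t)"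
      using w' t s by (simp add: u v_def)
    then show ?thesis using lat_member by metis
  qed
  ultimately show ?thesis using that[OF adm] by blast
qed

section \<open>Isomorphism types, and subgroups parametrised by natural numbers\<close>

lemma not_iso:
  "\<not> Z3 \<cong> pi1_B1" "\<not> Z3 \<cong> pi1_B2" "\<not> pi1_B1 \<cong> pi1_B2"
proof -
  have B1: "pi1_B1 \<cong> KZ" and B2: "pi1_B2 \<cong> KZ2"
    using group.iso_sym[OF group_KZ KZ_iso_pi1_B1] group.iso_sym[OF group_KZ2 KZ2_iso_pi1_B2] .
  show "\<not> Z3 \<cong> pi1_B1"
    using iso_trans[OF _ B1] commutes_iso[OF group_Z3 _ commutes_Z3] not_commutes_KZ by blast
  show "\<not> Z3 \<cong> pi1_B2"
    using iso_trans[OF _ B2] commutes_iso[OF group_Z3 _ commutes_Z3] not_commutes_KZ2 by blast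
  show "\<not> pi1_B1 \<cong> pi1_B2"
  proof
    assume "pi1_B1 \<cong> pi1_B2"
    then have "KZ \<cong> KZ2" using iso_trans[OF KZ_iso_pi1_B1 iso_trans[OF _ B2]] by simp
    then have "KZ2 \<cong> KZ" by (rule group.iso_sym[OF group_KZ])
    then show False
      using reversed_are_commutators_iso[OF group_KZ2 _ reversed_are_commutators_KZ2]
        not_reversed_are_commutators_KZ by blast
  qed
qed

lemma iso_Z3_B1_B2_exclusive:
  assumes "group G"
  shows "G \<cong> Z3 \<Longrightarrow> \<not> G \<cong> pi1_B1 \<and> \<not> G \<cong> pi1_B2"
    "G \<cong> pi1_B1 \<Longrightarrow> \<not> G \<cong> Z3 \<and> \<not> G \<cong> pi1_B2"
    "G \<cong> pi1_B2 \<Longrightarrow> \<not> G \<cong> Z3 \<and> \<not> G \<cong> pi1_B1"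
proof -
  note trans = iso_trans[OF group.iso_sym[OF assms]]
  show "G \<cong> Z3 \<Longrightarrow> \<not> G \<cong> pi1_B1 \<and> \<not> G \<cong> pi1_B2"
    using trans not_iso by metis
  show "G \<cong> pi1_B1 \<Longrightarrow> \<not> G \<cong> Z3 \<and> \<not> G \<cong> pi1_B2"
    using trans not_iso by metis
  show "G \<cong> pi1_B2 \<Longrightarrow> \<not> G \<cong> Z3 \<and> \<not> G \<cong> pi1_B1"
    using trans not_iso by metis
qed

text \<open>The admissible parameters of index \<open>n\<close>, over the naturals for counting; for
  \<open>n > 0\<close> the product equation makes \<open>d\<close>, \<open>f\<close>,
  \<open>k\<close> positive.\<close>

definition params :: "nat \<Rightarrow> (nat \<times> nat \<times> nat \<times> nat \<times> nat \<times> nat) set"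
  where "params n = {(d, f, k, e, p, q).
    d * (k * f) = n \<and> e < f \<and> p < k \<and> q < k \<and> (even d \<or> k dvd 2 * p)}"

definition lat_of :: "nat \<times> nat \<times> nat \<times> nat \<times> nat \<times> nat \<Rightarrow> (int \<times> int \<times> int) set"
  where "lat_of = (\<lambda>(d, f, k, e, p, q). lat (int d) (int f) (int k) (int e) (int p) (int q))"

lemma int_dvd_double: "int k dvd 2 * int p \<longleftrightarrow> k dvd 2 * p"
  using int_dvd_int_iff[of k "2 * p"] by simp

lemma params_iff_admissible:
  assumes "n > 0"
  shows "(d, f, k, e, p, q) \<in> params n \<longleftrightarrow>
    admissible (int d) (int f) (int k) (int e) (int p) (int q) \<and> d * (k * f) = n"
  using assms by (auto simp: params_def admissible_def int_dvd_double)

lemma bij_params_subgroups: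
  assumes "n > 0"
  shows "bij_betw lat_of (params n) (subgroups_of_index KZ n)"
  unfolding bij_betw_def
proof (intro conjI equalityI subsetI)
  show "inj_on lat_of (params n)"
  proof (rule inj_onI)
    fix t t' assume t: "t \<in> params n" "t' \<in> params n" "lat_of t = lat_of t'"
    obtain d f k e p q d' f' k' e' p' q' where
      t': "t = (d, f, k, e, p, q)" "t' = (d', f', k', e', p', q')"
      by (cases t; cases t')
    show "t = t'"
      using lat_inj[of "int d" "int f" "int k" "int e" "int p" "int q"
          "int d'" "int f'" "int k'" "int e'" "int p'" "int q'"] t
      by (simp add: t' params_iff_admissible[OF assms] lat_of_def)
  qed
  fix D assume "D \<in> subgroups_of_index KZ n"
  then have D: "subgroup D KZ" "card (rcosets\<^bsub>KZ\<^esub> D) = n"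
    by (auto simp: subgroups_of_index_def)
  \<comment> \<open>An infinite set has \<open>card\<close> equal to \<open>0\<close>, so a positive
    index is a finite one.\<close>
  then have "finite (rcosets\<^bsub>KZ\<^esub> D)" using assms card_gt_0_iff by metis
  with D(1) obtain d f k e p q where t: "admissible d f k e p q" "D = lat d f k e p q"
    by (rule lat_exhausts)
  then have "0 \<le> d" "0 \<le> f" "0 \<le> k" "0 \<le> e" "0 \<le> p" "0 \<le> q"
    by (auto simp: admissible_def)
  with t have "(nat d, nat f, nat k, nat e, nat p, nat q) \<in> params n"
    "D = lat_of (nat d, nat f, nat k, nat e, nat p, nat q)"
    using card_rcosets_lat[OF t(1)] D(2) by (simp_all add: params_iff_admissible[OF assms] lat_of_def)
  then show "D \<in> lat_of ` params n" by blast
next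
  fix D assume "D \<in> lat_of ` params n"
  then show "D \<in> subgroups_of_index KZ n"
    by (auto simp: params_iff_admissible[OF assms] lat_of_def subgroups_of_index_def subgroup_lat
        card_rcosets_lat)
qed

text \<open>Each admissible case exhibits one isomorphism; since the three types exclude each other,
  the implications become equivalences.\<close>

lemma lat_iso_type:
  assumes "admissible d f k e p q"
  shows "KZ\<lparr>carrier := lat d f k e p q\<rparr> \<cong> Z3 \<longleftrightarrow> even d"
    "KZ\<lparr>carrier := lat d f k e p q\<rparr> \<cong> pi1_B1 \<longleftrightarrow> odd d \<and> p = 0"
    "KZ\<lparr>carrier := lat d f k e p q\<rparr> \<cong> pi1_B2 \<longleftrightarrow> odd d \<and> p \<noteq> 0"
proof -
  define G where "G = KZ\<lparr>carrier := lat d f k e p q\<rparr>"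
  have "group G"
    unfolding G_def by (rule group.subgroup_imp_group[OF group_KZ subgroup_lat[OF assms]])
  note exclusive = iso_Z3_B1_B2_exclusive[OF this]
  have nz: "d \<noteq> 0" "f \<noteq> 0" "k \<noteq> 0" using assms by (auto simp: admissible_def)
  have "(G \<cong> Z3 \<longleftrightarrow> even d) \<and> (G \<cong> pi1_B1 \<longleftrightarrow> odd d \<and> p = 0) \<and> (G \<cong> pi1_B2 \<longleftrightarrow> odd d \<and> p \<noteq> 0)"
    using assms
  proof (cases rule: admissible_cases)
    case 1
    then have "G \<cong> Z3" unfolding G_def using nz by (intro lat_even(2))
    with 1 exclusive(1) show ?thesis by simp
  next
    case 2
    then have "G \<cong> KZ" unfolding G_def using nz lat_odd_KZ(2) by simp
    then have "G \<cong> pi1_B1" using KZ_iso_pi1_B1 by (rule iso_trans)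
    with 2 exclusive(2) show ?thesis by simp
  next
    case 3
    then have "G \<cong> KZ2" unfolding G_def using nz lat_odd_KZ2(2) by simp
    then have "G \<cong> pi1_B2" using KZ2_iso_pi1_B2 by (rule iso_trans)
    with 3 exclusive(3) show ?thesis by simp
  qed
  then show "KZ\<lparr>carrier := lat d f k e p q\<rparr> \<cong> Z3 \<longleftrightarrow> even d"
    "KZ\<lparr>carrier := lat d f k e p q\<rparr> \<cong> pi1_B1 \<longleftrightarrow> odd d \<and> p = 0"
    "KZ\<lparr>carrier := lat d f k e p q\<rparr> \<cong> pi1_B2 \<longleftrightarrow> odd d \<and> p \<noteq> 0"
    by (simp_all add: G_def)
qed

lemma card_bij_restrict:
  assumes "bij_betw h A B" "\<And>x. x \<in> A \<Longrightarrow> P (h x) \<longleftrightarrow> Q x"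
  shows "card {y \<in> B. P y} = card {x \<in> A. Q x}"
proof -
  have "bij_betw h {x \<in> A. Q x} {y \<in> B. P y}"
    using assms unfolding bij_betw_def by (auto intro: inj_on_subset)
  then show ?thesis by (simp add: bij_betw_same_card)
qed

lemma num_subgroups_pi1_B1: "num_subgroups H pi1_B1 n = num_subgroups H KZ n"
proof -
  have B1: "group pi1_B1" unfolding pi1_B1_def by (rule group_presented_group)
  obtain \<phi> where phi: "\<phi> \<in> iso KZ pi1_B1" using KZ_iso_pi1_B1 by (auto simp: is_iso_def)
  show ?thesis
    unfolding num_subgroups_def
  proof (rule card_bij_restrict[OF subgroups_of_index_bij[OF group_KZ B1 phi]])
    fix D assume D: "D \<in> subgroups_of_index KZ n"
    note iso = subgroups_of_index_iso(2)[OF group_KZ B1 phi D]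
    have "group (KZ\<lparr>carrier := D\<rparr>)"
      using D by (auto simp: subgroups_of_index_def intro: group.subgroup_imp_group[OF group_KZ])
    from iso_trans[OF group.iso_sym[OF this iso]] iso_trans[OF iso]
    show "pi1_B1\<lparr>carrier := \<phi> ` D\<rparr> \<cong> H \<longleftrightarrow> KZ\<lparr>carrier := D\<rparr> \<cong> H"
      by metis
  qed
qed

text \<open>The isomorphism type depends on \<open>d\<close> and \<open>p\<close> alone, so each
  count becomes a count of parameters.\<close>

lemma num_subgroups_params:
  assumes "n > 0"
    and "\<And>d f k e p q. admissible d f k e p q \<Longrightarrow>
      KZ\<lparr>carrier := lat d f k e p q\<rparr> \<cong> H \<longleftrightarrow> Q d p"
  shows "num_subgroups H pi1_B1 n = card {(d, f, k, e, p, q) \<in> params n. Q (int d) (int p)}"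
proof -
  have "num_subgroups H KZ n = card {t \<in> params n. case t of (d, f, k, e, p, q) \<Rightarrow> Q (int d) (int p)}"
    unfolding num_subgroups_def
    by (rule card_bij_restrict[OF bij_params_subgroups[OF assms(1)]])
      (auto simp: params_iff_admissible[OF assms(1)] lat_of_def assms(2))
  also have "{t \<in> params n. case t of (d, f, k, e, p, q) \<Rightarrow> Q (int d) (int p)} =
      {(d, f, k, e, p, q) \<in> params n. Q (int d) (int p)}"
    by auto
  finally show ?thesis by (simp only: num_subgroups_pi1_B1)
qed

subsection \<open>Counting\<close>

lemma finite_multiple_divisors:
  fixes n :: nat
  assumes "n > 0"
  shows "finite {l. 0 < l \<and> m * l dvd n}"
  by (rule finite_subset[OF _ finite_divisors_nat[OF assms]]) (auto dest: dvd_mult_right)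

text \<open>Here \<open>l = k * f\<close>, and \<open>d = n div l\<close> is even exactly when
  \<open>2 * l\<close> divides \<open>n\<close>. For \<open>k\<close> dividing \<open>l\<close>
  there are \<open>l div k\<close> choices of \<open>e\<close> and \<open>k\<close> each of
  \<open>p\<close> and \<open>q\<close>, in total \<open>k * l\<close>.\<close>

lemma card_params_even:
  assumes "n > 0"
  shows "card {(d, f, k, e, p, q) \<in> params n. even d} =
    (\<Sum>l | 0 < l \<and> 2 * l dvd n. sigma1 l * l)"
proof -
  define S where "S = (SIGMA l:{l. 0 < l \<and> 2 * l dvd n}. SIGMA k:{k. k dvd l}.
    {..<l div k} \<times> {..<k} \<times> {..<k})"
  have "bij_betw (\<lambda>(l, k, e, p, q). (n div l, l div k, k, e, p, q)) S
      {(d, f, k, e, p, q) \<in> params n. even d}"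
    by (rule bij_betwI[where g = "\<lambda>(d, f, k, e, p, q). (k * f, k, e, p, q)"])
      (use assms in \<open>auto simp: S_def params_def elim!: dvdE\<close>)
  then have "card {(d, f, k, e, p, q) \<in> params n. even d} = card S"
    by (simp add: bij_betw_same_card)
  also have "\<dots> = (\<Sum>l | 0 < l \<and> 2 * l dvd n. \<Sum>k | k dvd l. (l div k) * (k * k))"
    using finite_multiple_divisors[OF assms, of 2] by (simp add: S_def card_SigmaI)
  also have "\<dots> = (\<Sum>l | 0 < l \<and> 2 * l dvd n. sigma1 l * l)"
  proof (intro sum.cong HOL.refl)
    fix l :: nat
    have "(l div k) * (k * k) = k * l" if "k dvd l" for k :: nat
      using that by (cases "k = 0") (auto elim!: dvdE)
    then show "(\<Sum>k | k dvd l. (l div k) * (k * k)) = sigma1 l * l"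
      unfolding sigma1_def sum_distrib_right by (intro sum.cong) auto
  qed
  finally show ?thesis .
qed

definition sigma_odd :: "nat \<Rightarrow> nat"
  where "sigma_odd m = (\<Sum>f | f dvd m \<and> odd (m div f). f)"

text \<open>The divisors of \<open>m\<close> with even cofactor are those of \<open>m div 2\<close>
  if \<open>m\<close> is even, and there are none otherwise.\<close>

lemma sigma_odd_eq:
  assumes "m > 0"
  shows "sigma1 m = sigma_odd m + (if even m then sigma1 (m div 2) else 0)"
proof -
  have "{f. f dvd m \<and> even (m div f)} = (if even m then {f. f dvd m div 2} else {})"
    using assms by (auto simp: dvd_div_iff_mult mult.commute dest: dvd_mult_left dvd_mult_right)
  then have "(\<Sum>f | f dvd m \<and> even (m div f). f) = (if even m then sigma1 (m div 2) else 0)"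
    by (simp add: sigma1_def)
  moreover have "sigma1 m = sigma_odd m + (\<Sum>f | f dvd m \<and> even (m div f). f)"
    unfolding sigma1_def sigma_odd_def using finite_divisors_nat[OF assms]
    by (subst sum.union_disjoint[symmetric]) (auto intro!: sum.cong)
  ultimately show ?thesis by simp
qed

text \<open>Both odd cases have this shape, with \<open>k = m * l\<close>: \<open>m = 1\<close> for
  \<open>p = 0\<close>, and \<open>m = 2\<close> for \<open>k = 2 * p\<close>. The odd cofactor of
  \<open>f\<close> is \<open>d\<close>, and the box ranges over \<open>e\<close> and
  \<open>q\<close>.\<close>

lemma card_odd_cofactor_SIGMA:
  assumes "n > 0" "m > 0"
  shows "card (SIGMA l:{l. 0 < l \<and> m * l dvd n}.
      SIGMA f:{f. f dvd n div (m * l) \<and> odd (n div (m * l) div f)}. {..<f} \<times> {..<m * l}) =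
    (\<Sum>l | 0 < l \<and> m * l dvd n. sigma_odd (n div (m * l)) * (m * l))"
proof -
  have fin: "finite {f. f dvd n div (m * l) \<and> odd (n div (m * l) div f)}"
    if "0 < l" "m * l dvd n" for l
  proof -
    have "n div (m * l) > 0" using that assms by (auto simp: dvd_div_eq_0_iff)
    then show ?thesis using finite_divisors_nat by simp
  qed
  then show ?thesis
    using finite_multiple_divisors[OF assms(1), of m]
    by (subst card_SigmaI) (auto simp: sigma_odd_def sum_distrib_right intro!: sum.cong)
qed

lemma card_params_odd_zero:
  assumes "n > 0"
  shows "card {(d, f, k, e, p, q) \<in> params n. odd d \<and> p = 0} =
    (\<Sum>l | 0 < l \<and> l dvd n. sigma_odd (n div l) * l)"
proof -
  \<comment> \<open>The factors \<open>1 *\<close> match \<open>card_odd_cofactor_SIGMA\<close> at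
    \<open>m = 1\<close>.\<close>
  define S where "S = (SIGMA k:{k. 0 < k \<and> 1 * k dvd n}.
    SIGMA f:{f. f dvd n div (1 * k) \<and> odd (n div (1 * k) div f)}. {..<f} \<times> {..<1 * k})"
  have "bij_betw (\<lambda>(k, f, e, q). (n div k div f, f, k, e, 0, q)) S
      {(d, f, k, e, p, q) \<in> params n. odd d \<and> p = 0}"
    by (rule bij_betwI[where g = "\<lambda>(d, f, k, e, p, q). (k, f, e, q)"])
      (use assms in \<open>auto simp: S_def params_def elim!: dvdE\<close>)
  then have "card {(d, f, k, e, p, q) \<in> params n. odd d \<and> p = 0} = card S"
    by (simp add: bij_betw_same_card)
  then show ?thesis
    unfolding S_def card_odd_cofactor_SIGMA[OF assms zero_less_one] by simp
qed

lemma card_params_odd_nonzero: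
  assumes "n > 0"
  shows "card {(d, f, k, e, p, q) \<in> params n. odd d \<and> p \<noteq> 0} =
    (\<Sum>l | 0 < l \<and> 2 * l dvd n. sigma_odd (n div (2 * l)) * (2 * l))"
proof -
  define S where "S = (SIGMA l:{l. 0 < l \<and> 2 * l dvd n}.
    SIGMA f:{f. f dvd n div (2 * l) \<and> odd (n div (2 * l) div f)}. {..<f} \<times> {..<2 * l})"
  have k: "k = 2 * p" if "(d, f, k, e, p, q) \<in> params n" "odd d" "p \<noteq> 0" for d f k e p q
    using that by (auto simp: params_iff_admissible[OF assms] elim: admissible_cases)
  have "(d, f, k, e, p, q) \<in> params n \<and> odd d \<and> p \<noteq> 0 \<longleftrightarrow>
      odd d \<and> p \<noteq> 0 \<and> k = 2 * p \<and> d * (k * f) = n \<and> e < f \<and> q < k" for d f k e p q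
    using k[of d f k e p q] by (auto simp: params_def)
  then have eq: "{(d, f, k, e, p, q) \<in> params n. odd d \<and> p \<noteq> 0} = {(d, f, k, e, p, q).
      odd d \<and> p \<noteq> 0 \<and> k = 2 * p \<and> d * (k * f) = n \<and> e < f \<and> q < k}"
    by (simp only:)
  have "bij_betw (\<lambda>(l, f, e, q). (n div (2 * l) div f, f, 2 * l, e, l, q)) S
      {(d, f, k, e, p, q) \<in> params n. odd d \<and> p \<noteq> 0}"
    unfolding eq
    by (rule bij_betwI[where g = "\<lambda>(d, f, k, e, p, q). (p, f, e, q)"])
      (use assms in \<open>auto simp: S_def elim!: dvdE\<close>)
  then have "card {(d, f, k, e, p, q) \<in> params n. odd d \<and> p \<noteq> 0} = card S"
    by (simp add: bij_betw_same_card)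
  then show ?thesis
    unfolding S_def card_odd_cofactor_SIGMA[OF assms zero_less_numeral] .
qed

text \<open>\<open>sigma_odd_eq\<close> is summed over \<open>l\<close>; the cofactor
  \<open>n div (m * l)\<close> is even exactly when \<open>2 * m * l\<close> divides
  \<open>n\<close>.\<close>

lemma sum_sigma_odd:
  assumes "n > 0" "m > 0"
  shows "(\<Sum>l | 0 < l \<and> m * l dvd n. sigma1 (n div (m * l)) * l) =
    (\<Sum>l | 0 < l \<and> m * l dvd n. sigma_odd (n div (m * l)) * l) +
    (\<Sum>l | 0 < l \<and> 2 * m * l dvd n. sigma1 (n div (2 * m * l)) * l)"
proof -
  define L where "L = {l. 0 < l \<and> m * l dvd n}"
  have fin: "finite L" unfolding L_def by (rule finite_multiple_divisors[OF assms(1)])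
  have pos: "n div (m * l) > 0" if "l \<in> L" for l
    using that assms by (auto simp: L_def dvd_div_eq_0_iff)
  have "(\<Sum>l\<in>L. sigma1 (n div (m * l)) * l) = (\<Sum>l\<in>L. sigma_odd (n div (m * l)) * l) +
      (\<Sum>l\<in>L. if even (n div (m * l)) then sigma1 (n div (m * l) div 2) * l else 0)"
    unfolding sum.distrib[symmetric]
    by (intro sum.cong HOL.refl) (simp add: sigma_odd_eq[OF pos] distrib_right)
  also have "(\<Sum>l\<in>L. if even (n div (m * l)) then sigma1 (n div (m * l) div 2) * l else 0) =
      (\<Sum>l | l \<in> L \<and> even (n div (m * l)). sigma1 (n div (m * l) div 2) * l)"
    by (rule sum.inter_filter[OF fin, symmetric])
  also have "\<dots> = (\<Sum>l | 0 < l \<and> 2 * m * l dvd n. sigma1 (n div (2 * m * l)) * l)"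
  proof (rule sum.cong)
    show "{l \<in> L. even (n div (m * l))} = {l. 0 < l \<and> 2 * m * l dvd n}"
      using assms by (auto simp: L_def elim!: dvdE)
  qed (simp add: div_mult2_eq[symmetric] ac_simps)
  finally show ?thesis by (simp only: L_def)
qed

theorem theorem1:
  fixes n :: nat
  assumes "n > 0"
  shows "(\<forall>D \<in> subgroups_of_index pi1_B1 n.
            pi1_B1\<lparr>carrier := D\<rparr> \<cong> Z3
          \<or> pi1_B1\<lparr>carrier := D\<rparr> \<cong> pi1_B1
          \<or> pi1_B1\<lparr>carrier := D\<rparr> \<cong> pi1_B2)
    \<and> finite (subgroups_of_index pi1_B1 n)
    \<and> num_subgroups Z3 pi1_B1 n = (\<Sum>l | 0 < l \<and> 2 * l dvd n. sigma1 l * l)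
    \<and> int (num_subgroups pi1_B1 pi1_B1 n) =
        int (\<Sum>l | 0 < l \<and> l dvd n. sigma1 (n div l) * l)
        - int (\<Sum>l | 0 < l \<and> 2 * l dvd n. sigma1 (n div (2 * l)) * l)
    \<and> int (num_subgroups pi1_B2 pi1_B1 n) =
        int (\<Sum>l | 0 < l \<and> 2 * l dvd n. 2 * l * sigma1 (n div (2 * l)))
        - int (\<Sum>l | 0 < l \<and> 4 * l dvd n. 2 * l * sigma1 (n div (4 * l)))"
proof (intro conjI ballI)
  have B1: "group pi1_B1" unfolding pi1_B1_def by (rule group_presented_group)
  obtain \<phi> where phi: "\<phi> \<in> iso KZ pi1_B1" using KZ_iso_pi1_B1 by (auto simp: is_iso_def)
  note bij = bij_betw_trans[OF bij_params_subgroups[OF assms]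
      subgroups_of_index_bij[OF group_KZ B1 phi]]
  \<comment> \<open>\<open>d\<close>, \<open>f\<close>, \<open>k\<close> divide \<open>n\<close>,
    and \<open>e\<close>, \<open>p\<close>, \<open>q\<close> lie below \<open>f\<close> or
    \<open>k\<close>, so everything is bounded by \<open>n\<close>.\<close>
  have "params n \<subseteq> {..n} \<times> {..n} \<times> {..n} \<times> {..n} \<times> {..n} \<times> {..n}"
  proof
    fix t assume t: "t \<in> params n"
    obtain d f k e p q where t': "t = (d, f, k, e, p, q)" by (cases t)
    with t have "d dvd n" "f dvd n" "k dvd n" "e < f" "p < k" "q < k"
      by (auto simp: params_def)
    then show "t \<in> {..n} \<times> {..n} \<times> {..n} \<times> {..n} \<times> {..n} \<times> {..n}"
      using dvd_imp_le[OF _ assms] by (fastforce simp: t')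
  qed
  then have "finite (params n)" by (rule finite_subset) simp
  with bij show "finite (subgroups_of_index pi1_B1 n)"
    by (simp add: bij_betw_finite)
  fix D assume D: "D \<in> subgroups_of_index pi1_B1 n"
  obtain d f k e p q where t: "(d, f, k, e, p, q) \<in> params n" "D = \<phi> ` lat_of (d, f, k, e, p, q)"
  proof -
    have "D \<in> ((\<lambda>D. \<phi> ` D) \<circ> lat_of) ` params n"
      using D bij_betw_imp_surj_on[OF bij] by blast
    then show thesis using that by auto
  qed
  then have adm: "admissible (int d) (int f) (int k) (int e) (int p) (int q)"
    by (simp add: params_iff_admissible[OF assms])
  have L: "lat_of (d, f, k, e, p, q) \<in> subgroups_of_index KZ n"
    using bij_betwE[OF bij_params_subgroups[OF assms]] t(1) by blast
  then have "group (KZ\<lparr>carrier := lat_of (d, f, k, e, p, q)\<rparr>)"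
    by (auto simp: subgroups_of_index_def intro: group.subgroup_imp_group[OF group_KZ])
  then have "pi1_B1\<lparr>carrier := D\<rparr> \<cong> KZ\<lparr>carrier := lat_of (d, f, k, e, p, q)\<rparr>"
    unfolding t(2) by (rule group.iso_sym[OF _ subgroups_of_index_iso(2)[OF group_KZ B1 phi L]])
  note trans = iso_trans[OF this, unfolded lat_of_def prod.case]
  show "pi1_B1\<lparr>carrier := D\<rparr> \<cong> Z3 \<or> pi1_B1\<lparr>carrier := D\<rparr> \<cong> pi1_B1 \<or> pi1_B1\<lparr>carrier := D\<rparr> \<cong> pi1_B2"
    using trans lat_iso_type[OF adm] by metis
next
  show "num_subgroups Z3 pi1_B1 n = (\<Sum>l | 0 < l \<and> 2 * l dvd n. sigma1 l * l)"
    using num_subgroups_params[OF assms lat_iso_type(1)] card_params_even[OF assms] by simp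
  show "int (num_subgroups pi1_B1 pi1_B1 n) =
        int (\<Sum>l | 0 < l \<and> l dvd n. sigma1 (n div l) * l)
        - int (\<Sum>l | 0 < l \<and> 2 * l dvd n. sigma1 (n div (2 * l)) * l)"
    using num_subgroups_params[OF assms lat_iso_type(2)] card_params_odd_zero[OF assms]
      sum_sigma_odd[OF assms zero_less_one] by simp
  have "(\<Sum>l | 0 < l \<and> m * l dvd n. 2 * l * F l) = 2 * (\<Sum>l | 0 < l \<and> m * l dvd n. F l * l)"
    for m :: nat and F :: "nat \<Rightarrow> nat"
    by (simp add: sum_distrib_left ac_simps)
  moreover have "num_subgroups pi1_B2 pi1_B1 n =
      2 * (\<Sum>l | 0 < l \<and> 2 * l dvd n. sigma_odd (n div (2 * l)) * l)"
    using num_subgroups_params[OF assms lat_iso_type(3)] card_params_odd_nonzero[OF assms]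
    by (simp add: sum_distrib_left ac_simps)
  \<comment> \<open>\<open>num.Bit0 num.One\<close> is the numeral 2: \<open>sum_sigma_odd\<close>
    at \<open>m = 2\<close> gives the divisor conditions with \<open>2 * l\<close> and
    \<open>4 * l\<close>.\<close>
  ultimately show "int (num_subgroups pi1_B2 pi1_B1 n) =
        int (\<Sum>l | 0 < l \<and> 2 * l dvd n. 2 * l * sigma1 (n div (2 * l)))
        - int (\<Sum>l | 0 < l \<and> 4 * l dvd n. 2 * l * sigma1 (n div (4 * l)))"
    using sum_sigma_odd[OF assms zero_less_numeral, of "num.Bit0 num.One"] by simp
qed

end
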